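(* Let $n\ge 3$ and $2\le l\le n-1$. Let $\mathrm{tw}_l(P_n)$ be the graph obtained from the path $v_1v_2\cdots v_n$ by adding a new vertex $v'$ adjacent to $v_{l-1},v_l,v_{l+1}$. Then \begin{align*} \frac{X_{\mathrm{tw}_l(P_n)}}{2}&=\sum_{I\vDash n,\ \Theta_I(l-1)\ge 3}w_Ie_{I1}+\sum_{I\in\mathcal W_n,\ \Theta_I(n-l)\ge 3}w_Ie_{I1}+\sum_{I\in\mathcal W_n}\Bigl(1-\frac{2}{i_1}\Bigr)w_Ie_{I1}\\ &\quad+\sum_{K\in\mathcal W_{n+1},\ \Theta_K(l-1)\le 2}\Bigl(1-\frac{1}{\Theta_K(l+\Theta_K(l-1))}\Bigr)w_Ke_K+\sum_{K\in\mathcal W_{n+1},\ \Theta_K(l-1)\ge 3}2w_Ke_K. \end{align*}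
   Context: $X_G=\sum_\kappa\prod_{v\in V(G)}x_{\kappa(v)}$ summed over proper colorings $\kappa:V(G)\to\{1,2,\dots\}$. A composition $I=i_1\cdots i_l\vDash n$ is a sequence of positive integers with sum $n$. $e_I=e_{i_1}\cdots e_{i_l}$ with $e_k$ elementary symmetric functions; $e_{I1}=e_Ie_1$. $w_I=i_1(i_2-1)\cdots(i_l-1)$. $\mathcal W_n$ is the set of compositions of $n$ all of whose parts are at least $2$. For $0\le c\le n$, $\sigma_I(c)=\min\{i_1+\dots+i_j:0\le j\le l,\ i_1+\dots+i_j\ge c\}$ and $\Theta_I(c)=\sigma_I(c)-c$. *)

theory Defs
  imports Complex_Main "HOL-Library.Poly_Mapping" "HOL-Library.FuncSet"
begin

section \<open>Formal power series in the variables \<open>x\<^sub>0, x\<^sub>1, x\<^sub>2, \<dots>\<close>\<close>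

text \<open>
  A monomial is a finitely supported exponent vector \<open>nat \<Rightarrow>\<^sub>0 nat\<close>, and a power series is an
  arbitrary family of coefficients indexed by monomials. The chromatic symmetric function and the
  elementary symmetric functions below only involve the variables \<open>x\<^sub>1, x\<^sub>2, \<dots>\<close>.
\<close>

type_synonym monom = "nat \<Rightarrow>\<^sub>0 nat"

typedef 'a mps = "UNIV :: (monom \<Rightarrow> 'a) set"
  morphisms mps_coeff Abs_mps ..

(* the exponent vectors must stay abstract when power series are unfolded *)
lifting_forget poly_mapping.lifting

setup_lifting type_definition_mps

lemma mps_eqI: "(\<And>m. mps_coeff f m = mps_coeff g m) \<Longrightarrow> f = g"
  by transfer auto

lemma finite_monom_splits: "finite {p :: monom \<times> monom. fst p + snd p = m}"
proof -
  let ?B = "{f :: nat \<Rightarrow> nat. \<forall>i. (i \<in> Poly_Mapping.keys m \<longrightarrow> f i \<in> {..Max (insert 0 (range (Poly_Mapping.lookup m)))}) \<and>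
      (i \<notin> Poly_Mapping.keys m \<longrightarrow> f i = 0)}"
  have fin_range: "finite (range (Poly_Mapping.lookup m))"
  proof -
    have "range (Poly_Mapping.lookup m) \<subseteq> insert 0 (Poly_Mapping.lookup m ` Poly_Mapping.keys m)"
      by (auto simp: in_keys_iff)
    then show ?thesis
      by (rule finite_subset) simp
  qed
  have "Poly_Mapping.lookup a \<in> ?B" if "a + b = m" for a b :: monom
  proof -
    have le: "Poly_Mapping.lookup a i \<le> Poly_Mapping.lookup m i" for i
      using that by (auto simp: lookup_add)
    have "Poly_Mapping.lookup m i \<le> Max (insert 0 (range (Poly_Mapping.lookup m)))" for i
      using fin_range by (intro Max_ge) auto
    then have "Poly_Mapping.lookup a i \<le> Max (insert 0 (range (Poly_Mapping.lookup m)))" for i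
      using le order_trans by blast
    moreover have "Poly_Mapping.lookup a i = 0" if "i \<notin> Poly_Mapping.keys m" for i
      using le[of i] that by (simp add: in_keys_iff)
    ultimately show ?thesis
      by auto
  qed
  then have "Poly_Mapping.lookup ` fst ` {p :: monom \<times> monom. fst p + snd p = m} \<subseteq> ?B"
    by auto
  moreover have "finite ?B"
    by (rule finite_set_of_finite_funs) simp_all
  ultimately have "finite (Poly_Mapping.lookup ` fst ` {p :: monom \<times> monom. fst p + snd p = m})"
    by (rule finite_subset)
  then have "finite (fst ` {p :: monom \<times> monom. fst p + snd p = m})"
    by (rule finite_imageD) (auto simp: inj_on_def)
  then show ?thesis
    by (rule finite_imageD) (auto simp: inj_on_def)
qed

instantiation mps :: (comm_ring_1) comm_ring_1
begin

lift_definition zero_mps :: "'a mps" is "\<lambda>_. 0" .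
lift_definition one_mps :: "'a mps" is "\<lambda>m. if m = 0 then 1 else 0" .
lift_definition plus_mps :: "'a mps \<Rightarrow> 'a mps \<Rightarrow> 'a mps" is "\<lambda>f g m. f m + g m" .
lift_definition minus_mps :: "'a mps \<Rightarrow> 'a mps \<Rightarrow> 'a mps" is "\<lambda>f g m. f m - g m" .
lift_definition uminus_mps :: "'a mps \<Rightarrow> 'a mps" is "\<lambda>f m. - f m" .
lift_definition times_mps :: "'a mps \<Rightarrow> 'a mps \<Rightarrow> 'a mps" is
  "\<lambda>f g m. \<Sum>p | fst p + snd p = m. f (fst p) * g (snd p)" .

instance
proof
  fix f g h :: "'a mps"
  show "f + g + h = f + (g + h)" by transfer (auto simp: add.assoc)
  show "f + g = g + f" by transfer (auto simp: add.commute)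
  show "0 + f = f" by transfer auto
  show "- f + f = 0" by transfer auto
  show "f - g = f + - g" by transfer auto
  show "(f + g) * h = f * h + g * h"
    by transfer (auto simp: sum.distrib distrib_right)
  show "(0 :: 'a mps) \<noteq> 1"
    by transfer (metis zero_neq_one)
  show "f * g = g * f"
  proof (rule mps_eqI)
    fix m
    show "mps_coeff (f * g) m = mps_coeff (g * f) m"
      unfolding times_mps.rep_eq
      by (rule sum.reindex_bij_witness[where i = prod.swap and j = prod.swap])
        (auto simp: add.commute mult.commute)
  qed
  show "1 * f = f"
  proof (rule mps_eqI)
    fix m
    have "mps_coeff (1 * f) m =
        (\<Sum>p | fst p + snd p = m. if p = (0, m) then mps_coeff f m else 0)"
      unfolding times_mps.rep_eq one_mps.rep_eq by (intro sum.cong) auto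
    also have "\<dots> = mps_coeff f m"
      using finite_monom_splits[of m] by simp
    finally show "mps_coeff (1 * f) m = mps_coeff f m" .
  qed
  show "f * g * h = f * (g * h)"
  proof (rule mps_eqI)
    fix m
    let ?S = "\<lambda>m. {p :: monom \<times> monom. fst p + snd p = m}"
    have "mps_coeff (f * g * h) m =
        (\<Sum>p\<in>?S m. \<Sum>q\<in>?S (fst p). mps_coeff f (fst q) * mps_coeff g (snd q) * mps_coeff h (snd p))"
      by (simp add: times_mps.rep_eq sum_distrib_right)
    also have "\<dots> = (\<Sum>(p, q)\<in>Sigma (?S m) (\<lambda>p. ?S (fst p)).
        mps_coeff f (fst q) * mps_coeff g (snd q) * mps_coeff h (snd p))"
      by (rule sum.Sigma) (simp_all add: finite_monom_splits)
    also have "\<dots> = (\<Sum>(p, q)\<in>Sigma (?S m) (\<lambda>p. ?S (snd p)).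
        mps_coeff f (fst p) * (mps_coeff g (fst q) * mps_coeff h (snd q)))"
      by (rule sum.reindex_bij_witness
          [where j = "\<lambda>(p, q). ((fst q, snd q + snd p), (snd q, snd p))"
             and i = "\<lambda>(p, q). ((fst p + fst q, snd q), (fst p, fst q))"])
        (auto simp: add.assoc mult.assoc)
    also have "\<dots> = (\<Sum>p\<in>?S m. \<Sum>q\<in>?S (snd p).
        mps_coeff f (fst p) * (mps_coeff g (fst q) * mps_coeff h (snd q)))"
      by (rule sum.Sigma[symmetric]) (simp_all add: finite_monom_splits)
    also have "\<dots> = mps_coeff (f * (g * h)) m"
      by (simp add: times_mps.rep_eq sum_distrib_left)
    finally show "mps_coeff (f * g * h) m = mps_coeff (f * (g * h)) m" .
  qed
qed

end

lift_definition mps_smult :: "'a :: comm_ring_1 \<Rightarrow> 'a mps \<Rightarrow> 'a mps" is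
  "\<lambda>c f m. c * f m" .

text \<open>
  \<open>monom_sum A \<mu>\<close> is the formal sum of the monomials with exponent vectors \<open>\<mu> a\<close>, for \<open>a \<in> A\<close>.
  It is meaningful for infinite \<open>A\<close> provided that every monomial occurs only finitely often; this
  is shown below for both families to which it is applied.
\<close>

lift_definition monom_sum :: "'b set \<Rightarrow> ('b \<Rightarrow> monom) \<Rightarrow> 'a :: comm_ring_1 mps" is
  "\<lambda>A \<mu> m. of_nat (card {a \<in> A. \<mu> a = m})" .

lemma keys_sum_single:
  fixes \<kappa> :: "'v \<Rightarrow> nat"
  assumes "finite V"
  shows "Poly_Mapping.keys (\<Sum>v\<in>V. Poly_Mapping.single (\<kappa> v) (1 :: nat)) = \<kappa> ` V"
  using assms
proof (induction V)
  case (insert v V)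
  have "Poly_Mapping.keys (a + b) = Poly_Mapping.keys a \<union> Poly_Mapping.keys b" for a b :: monom
    by (auto simp: in_keys_iff lookup_add)
  with insert show ?case
    by simp
qed simp


section \<open>Elementary symmetric functions\<close>

definition esym :: "nat \<Rightarrow> 'a :: comm_ring_1 mps" where
  "esym k = monom_sum {S. S \<subseteq> {1..} \<and> finite S \<and> card S = k}
     (\<lambda>S. \<Sum>i\<in>S. Poly_Mapping.single i 1)"

lemma finite_esym_fibre:
  "finite {S \<in> {S :: nat set. S \<subseteq> {1..} \<and> finite S \<and> card S = k}.
     (\<Sum>i\<in>S. Poly_Mapping.single i (1 :: nat)) = m}"
proof (rule finite_subset)
  show "{S \<in> {S :: nat set. S \<subseteq> {1..} \<and> finite S \<and> card S = k}.
      (\<Sum>i\<in>S. Poly_Mapping.single i (1 :: nat)) = m} \<subseteq> Pow (Poly_Mapping.keys m)"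
  proof
    fix S
    assume "S \<in> {S \<in> {S. S \<subseteq> {1..} \<and> finite S \<and> card S = k}.
      (\<Sum>i\<in>S. Poly_Mapping.single i (1 :: nat)) = m}"
    then have "finite S" and m: "(\<Sum>i\<in>S. Poly_Mapping.single i (1 :: nat)) = m"
      by blast+
    from keys_sum_single[OF this(1), of "\<lambda>i. i"] have "Poly_Mapping.keys m = S"
      unfolding m by simp
    then show "S \<in> Pow (Poly_Mapping.keys m)"
      by simp
  qed
qed simp

definition esym_comp :: "nat list \<Rightarrow> 'a :: comm_ring_1 mps" where
  "esym_comp I = (\<Prod>i\<leftarrow>I. esym i)"


section \<open>Chromatic symmetric functions\<close>

text \<open>A simple graph is given by its vertex set and its set of two-element edges.\<close>

type_synonym 'v ugraph = "'v set \<times> 'v set set"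

definition proper_colorings :: "'v ugraph \<Rightarrow> ('v \<Rightarrow> nat) set" where
  "proper_colorings G =
     {\<kappa> \<in> fst G \<rightarrow>\<^sub>E {1..}. \<forall>u v. {u, v} \<in> snd G \<longrightarrow> \<kappa> u \<noteq> \<kappa> v}"

definition chromatic_sf :: "'v ugraph \<Rightarrow> 'a :: comm_ring_1 mps" where
  "chromatic_sf G = monom_sum (proper_colorings G)
     (\<lambda>\<kappa>. \<Sum>v\<in>fst G. Poly_Mapping.single (\<kappa> v) 1)"

lemma finite_chromatic_fibre:
  assumes "finite (fst G)"
  shows "finite {\<kappa> \<in> proper_colorings G.
    (\<Sum>v\<in>fst G. Poly_Mapping.single (\<kappa> v) (1 :: nat)) = m}"
proof (rule finite_subset)
  show "{\<kappa> \<in> proper_colorings G. (\<Sum>v\<in>fst G. Poly_Mapping.single (\<kappa> v) (1 :: nat)) = m}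
      \<subseteq> fst G \<rightarrow>\<^sub>E Poly_Mapping.keys m"
  proof
    fix \<kappa>
    assume "\<kappa> \<in> {\<kappa> \<in> proper_colorings G.
      (\<Sum>v\<in>fst G. Poly_Mapping.single (\<kappa> v) (1 :: nat)) = m}"
    then have ext: "\<kappa> \<in> fst G \<rightarrow>\<^sub>E {1..}"
      and m: "(\<Sum>v\<in>fst G. Poly_Mapping.single (\<kappa> v) (1 :: nat)) = m"
      unfolding proper_colorings_def by blast+
    from keys_sum_single[OF assms, of \<kappa>] have "Poly_Mapping.keys m = \<kappa> ` fst G"
      unfolding m .
    with ext show "\<kappa> \<in> fst G \<rightarrow>\<^sub>E Poly_Mapping.keys m"
      by (simp add: PiE_iff)
  qed
  show "finite (fst G \<rightarrow>\<^sub>E Poly_Mapping.keys m)"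
    using assms by (intro finite_PiE) simp_all
qed

definition path_graph :: "nat \<Rightarrow> nat ugraph" where
  "path_graph n = ({1..n}, {{i, i + 1} | i. 1 \<le> i \<and> i < n})"

text \<open>The path vertex \<open>v\<^sub>i\<close> is \<open>i\<close>; the new vertex \<open>v'\<close> is \<open>0\<close>.\<close>

definition twin_path :: "nat \<Rightarrow> nat \<Rightarrow> nat ugraph" where
  "twin_path l n =
     (insert 0 (fst (path_graph n)), snd (path_graph n) \<union> {{0, l - 1}, {0, l}, {0, l + 1}})"


section \<open>Compositions\<close>

definition compositions :: "nat \<Rightarrow> nat list set" where
  "compositions n = {I. (\<forall>i\<in>set I. 1 \<le> i) \<and> sum_list I = n}"

definition compositions_ge2 :: "nat \<Rightarrow> nat list set" where
  "compositions_ge2 n = {I \<in> compositions n. \<forall>i\<in>set I. 2 \<le> i}"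

lemma finite_compositions: "finite (compositions n)"
proof (rule finite_subset)
  have "length I \<le> sum_list I" if "\<forall>i\<in>set I. 1 \<le> i" for I :: "nat list"
    using that by (induction I) auto
  then show "compositions n \<subseteq> {I. set I \<subseteq> {..n} \<and> length I \<le> n}"
    by (auto simp: compositions_def member_le_sum_list)
qed (simp add: finite_lists_length_le)

lemma finite_compositions_ge2: "finite (compositions_ge2 n)"
  by (rule finite_subset[OF _ finite_compositions]) (auto simp: compositions_ge2_def)

text \<open>For a nonempty list of positive parts; natural number subtraction is then not truncated.\<close>

definition comp_weight :: "nat list \<Rightarrow> nat" where
  "comp_weight I = hd I * (\<Prod>i\<leftarrow>tl I. i - 1)"

text \<open>
  For \<open>c \<le> sum_list I\<close> the minimum is over a nonempty set, and \<open>comp_sigma I c \<ge> c\<close>.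
\<close>

definition comp_sigma :: "nat list \<Rightarrow> nat \<Rightarrow> nat" where
  "comp_sigma I c = Min {sum_list (take j I) | j. j \<le> length I \<and> c \<le> sum_list (take j I)}"

definition comp_theta :: "nat list \<Rightarrow> nat \<Rightarrow> nat" where
  "comp_theta I c = comp_sigma I c - c"

end

theory Submission
  imports Defs
begin

text \<open>
  Let \<open>P\<^sub>n\<close> be the chromatic symmetric function of the path, \<open>a = l - 1\<close> and \<open>b = n - l\<close>. Since the twin
  vertices \<open>v\<^sub>l\<close> and \<open>v'\<close> receive distinct colors, at most one of them can share a color with a given
  common neighbour; inclusion-exclusion on these coincidences gives
  \<open>X / 2 = 2 P\<^sub>n\<^sub>+\<^sub>1 + P\<^sub>1 P\<^sub>n - P\<^sub>a\<^sub>+\<^sub>1 P\<^sub>b\<^sub>+\<^sub>1 - P\<^sub>a\<^sub>+\<^sub>2 P\<^sub>b - P\<^sub>a P\<^sub>b\<^sub>+\<^sub>2 + e\<^sub>2 P\<^sub>a P\<^sub>b\<close>.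
  The path functions satisfy \<open>P\<^sub>n = n e\<^sub>n + \<Sum>\<^sub>1\<^sub>\<le>\<^sub>j\<^sub><\<^sub>n (j - 1) e\<^sub>j P\<^sub>n\<^sub>-\<^sub>j\<close>, so \<open>P\<^sub>n = \<Sum> w\<^sub>I e\<^sub>I\<close>. Cutting a composition
  at the partial sum \<open>\<sigma>\<^sub>I(c)\<close> expresses each of the five sums through \<open>P\<^sub>m\<close>, its part over compositions
  without first part \<open>1\<close>, and \<open>A\<^sub>m = \<Sum> \<Prod> (i - 1) e\<^sub>I\<close>; the claim is then a ring identity.
\<close>

section \<open>Sums over compositions\<close>

text \<open>The first part gets its own weight \<open>\<phi>\<close>: with \<open>k * e_k\<close>
  for the first part and \<open>(k - 1) * e_k\<close> for the later ones the product is
  \<open>w_I e_I\<close>. Varying \<open>\<phi>\<close> alone then covers all the sums of the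
  theorem.\<close>

fun comp_prod :: "(nat \<Rightarrow> 'a :: comm_ring_1) \<Rightarrow> (nat \<Rightarrow> 'a) \<Rightarrow> nat list \<Rightarrow> 'a" where
  "comp_prod \<phi> \<psi> [] = 1"
| "comp_prod \<phi> \<psi> (i # I) = \<phi> i * prod_list (map \<psi> I)"

definition comp_sum :: "(nat \<Rightarrow> 'a :: comm_ring_1) \<Rightarrow> (nat \<Rightarrow> 'a) \<Rightarrow> nat \<Rightarrow> 'a" where
  "comp_sum \<phi> \<psi> n = (\<Sum>I\<in>compositions n. comp_prod \<phi> \<psi> I)"

lemma comp_prod_append:
  "J \<noteq> [] \<Longrightarrow> comp_prod \<phi> \<psi> (J @ K) = comp_prod \<phi> \<psi> J * prod_list (map \<psi> K)"
  by (cases J) (auto simp: mult.assoc)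

lemma comp_prod_same: "comp_prod \<psi> \<psi> I = prod_list (map \<psi> I)"
  by (cases I) auto

lemma compositions_0: "compositions 0 = {[]}"
proof (intro equalityI subsetI)
  fix I assume "I \<in> compositions 0"
  then show "I \<in> {[]}" by (cases I) (auto simp: compositions_def)
qed (auto simp: compositions_def)

lemma compositions_nonempty: "0 < n \<Longrightarrow> I \<in> compositions n \<Longrightarrow> I \<noteq> []"
  by (auto simp: compositions_def)

lemma comp_sum_0 [simp]: "comp_sum \<phi> \<psi> 0 = 1"
  by (simp add: comp_sum_def compositions_0)

lemma comp_sum_add:
  "0 < n \<Longrightarrow> comp_sum (\<lambda>k. \<phi> k + \<phi>' k) \<psi> n = comp_sum \<phi> \<psi> n + comp_sum \<phi>' \<psi> n"
  unfolding comp_sum_def sum.distrib [symmetric]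
  by (intro sum.cong refl, rename_tac I, case_tac I)
    (auto simp: distrib_right dest: compositions_nonempty)

lemma comp_sum_cmult:
  "0 < n \<Longrightarrow> comp_sum (\<lambda>k. c * \<phi> k) \<psi> n = c * comp_sum \<phi> \<psi> n"
  unfolding comp_sum_def sum_distrib_left
  by (intro sum.cong refl, rename_tac I, case_tac I)
    (auto simp: mult.assoc dest: compositions_nonempty)

text \<open>Once a first part 1 is forced and removed, what remains is an arbitrary composition
  whose parts were all later parts, so its head is weighted by \<open>\<psi>\<close> too.\<close>

lemma comp_sum_first_one:
  "0 < n \<Longrightarrow> comp_sum (\<lambda>k. if k = 1 then c else 0) \<psi> n = c * comp_sum \<psi> \<psi> (n - 1)"
proof -
  assume n: "0 < n"
  let ?\<delta> = "\<lambda>k :: nat. if k = 1 then c else 0"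
  have "comp_sum ?\<delta> \<psi> n = (\<Sum>I\<in>(#) 1 ` compositions (n - 1). comp_prod ?\<delta> \<psi> I)"
    unfolding comp_sum_def
  proof (rule sum.mono_neutral_right)
    show "(#) 1 ` compositions (n - 1) \<subseteq> compositions n"
      using n by (auto simp: compositions_def)
    show "\<forall>I\<in>compositions n - (#) 1 ` compositions (n - 1). comp_prod ?\<delta> \<psi> I = 0"
    proof
      fix I assume I: "I \<in> compositions n - (#) 1 ` compositions (n - 1)"
      with n obtain i K where IK: "I = i # K"
        by (cases I) (auto simp: compositions_def)
      with I have "i \<noteq> 1"
        by (auto simp: compositions_def image_iff)
      with IK show "comp_prod ?\<delta> \<psi> I = 0" by simp
    qed
  qed (simp add: finite_compositions)
  also have "\<dots> = c * comp_sum \<psi> \<psi> (n - 1)"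
    by (subst sum.reindex) (auto simp: comp_sum_def sum_distrib_left comp_prod_same)
  finally show ?thesis .
qed

text \<open>Because \<open>j < m\<close>, the last part is not also the first one. It therefore
  carries \<open>\<psi>\<close>, and \<open>butlast\<close> leaves a nonempty composition of
  \<open>m - j\<close>.\<close>

lemma comp_sum_last:
  assumes "0 < j" "j < m"
  shows "(\<Sum>J | J \<in> compositions m \<and> last J = j. comp_prod \<phi> \<psi> J) = \<psi> j * comp_sum \<phi> \<psi> (m - j)"
proof -
  have "(\<Sum>J | J \<in> compositions m \<and> last J = j. comp_prod \<phi> \<psi> J) =
      (\<Sum>J\<in>compositions (m - j). comp_prod \<phi> \<psi> (J @ [j]))"
  proof (rule sum.reindex_bij_witness[where j = butlast and i = "\<lambda>J. J @ [j]"])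
    fix J assume J: "J \<in> {J \<in> compositions m. last J = j}"
    with assms have "J \<noteq> []" by (auto simp: compositions_def)
    then have eq: "butlast J @ [j] = J" using J by (metis (mono_tags) append_butlast_last_id mem_Collect_eq)
    then show "butlast J @ [j] = J" .
    have "sum_list J = sum_list (butlast J) + j" by (subst eq[symmetric]) simp
    with J show "butlast J \<in> compositions (m - j)"
      by (auto simp: compositions_def dest: in_set_butlastD)
    show "comp_prod \<phi> \<psi> (butlast J @ [j]) = comp_prod \<phi> \<psi> J" by (simp add: eq)
  qed (use assms in \<open>auto simp: compositions_def\<close>)
  also have "\<dots> = (\<Sum>J\<in>compositions (m - j). \<psi> j * comp_prod \<phi> \<psi> J)"
    using assms
    by (intro sum.cong refl) (auto simp: comp_prod_append mult.commute dest!: compositions_nonempty[rotated])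
  finally show ?thesis by (simp add: comp_sum_def sum_distrib_left)
qed

lemma composition_last_le:
  assumes "J \<in> compositions m" "0 < m"
  shows "0 < last J" "last J \<le> m"
proof -
  have "last J \<in> set J" using compositions_nonempty[OF assms(2,1)] by simp
  then show "0 < last J" "last J \<le> m"
    using assms member_le_sum_list[of "last J" J] by (auto simp: compositions_def)
qed

lemma composition_last_eq:
  assumes "J \<in> compositions m" "0 < m" "last J = m"
  shows "J = [m]"
proof -
  have J: "J = butlast J @ [m]" using compositions_nonempty[OF assms(2,1)] assms(3)
    by (metis append_butlast_last_id)
  then have "sum_list J = sum_list (butlast J) + m"
    by (metis sum_list_append sum_list.Cons sum_list.Nil add_0_right)
  with assms(1) have "sum_list (butlast J) = 0" "\<forall>i\<in>set (butlast J). 1 \<le> i"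
    by (auto simp: compositions_def dest: in_set_butlastD)
  then have "butlast J = []" by (cases "butlast J") auto
  with J show ?thesis by simp
qed

text \<open>Group by the last part; only the one-part composition \<open>[m]\<close> has last part
  \<open>m\<close>, and there the part is weighted by \<open>\<phi>\<close>.\<close>

lemma comp_sum_rec:
  assumes "0 < m"
  shows "comp_sum \<phi> \<psi> m = \<phi> m + (\<Sum>j=1..<m. \<psi> j * comp_sum \<phi> \<psi> (m - j))"
proof -
  have "comp_sum \<phi> \<psi> m = (\<Sum>j\<in>{1..m}. \<Sum>J | J \<in> compositions m \<and> last J = j. comp_prod \<phi> \<psi> J)"
    unfolding comp_sum_def
    by (rule sum.group[symmetric])
      (use assms composition_last_le in \<open>force simp: finite_compositions Suc_le_eq\<close>)+
  also have "\<dots> = (\<Sum>J | J \<in> compositions m \<and> last J = m. comp_prod \<phi> \<psi> J) +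
      (\<Sum>j=1..<m. \<Sum>J | J \<in> compositions m \<and> last J = j. comp_prod \<phi> \<psi> J)"
    using assms by (subst sum.last_plus) auto
  also have "{J. J \<in> compositions m \<and> last J = m} = {[m]}"
    using assms composition_last_eq by (auto simp: compositions_def)
  finally show ?thesis by (simp add: comp_sum_last)
qed

text \<open>
  A composition \<open>I\<close> of \<open>n\<close> with \<open>\<Theta>\<^sub>I(c) = t\<close> is \<open>J @ K\<close> for a composition \<open>J\<close> of \<open>c + t\<close> whose last part
  exceeds \<open>t\<close> and an arbitrary composition \<open>K\<close> of \<open>n - c - t\<close>.
\<close>

definition tail_sum :: "(nat \<Rightarrow> 'a :: comm_ring_1) \<Rightarrow> (nat \<Rightarrow> 'a) \<Rightarrow> nat \<Rightarrow> nat \<Rightarrow> 'a" where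
  "tail_sum \<phi> \<psi> c t = (\<Sum>J | J \<in> compositions (c + t) \<and> t < last J. comp_prod \<phi> \<psi> J)"

lemma tail_sum_0: "0 < c \<Longrightarrow> tail_sum \<phi> \<psi> c 0 = comp_sum \<phi> \<psi> c"
  unfolding tail_sum_def comp_sum_def
  by (intro sum.cong refl) (auto dest: composition_last_le)

text \<open>Both tail sums run over compositions of \<open>c + t + 1\<close>; they differ exactly in
  those with last part \<open>t + 1\<close>, which \<open>comp_sum_last\<close> evaluates since
  \<open>c > 0\<close>.\<close>

lemma tail_sum_Suc:
  assumes "0 < c"
  shows "tail_sum \<phi> \<psi> c (Suc t) =
    tail_sum \<phi> \<psi> (Suc c) t - \<psi> (Suc t) * comp_sum \<phi> \<psi> c"
proof -
  have "{J. J \<in> compositions (Suc c + t) \<and> t < last J} =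
     {J. J \<in> compositions (c + Suc t) \<and> Suc t < last J} \<union>
     {J. J \<in> compositions (c + Suc t) \<and> last J = Suc t}"
    by auto
  then have "tail_sum \<phi> \<psi> (Suc c) t = tail_sum \<phi> \<psi> c (Suc t) +
      (\<Sum>J | J \<in> compositions (c + Suc t) \<and> last J = Suc t. comp_prod \<phi> \<psi> J)"
    unfolding tail_sum_def by (simp only:) (subst sum.union_disjoint, auto simp: finite_compositions)
  also have "(\<Sum>J | J \<in> compositions (c + Suc t) \<and> last J = Suc t. comp_prod \<phi> \<psi> J) =
      \<psi> (Suc t) * comp_sum \<phi> \<psi> c"
    using assms by (subst comp_sum_last) auto
  finally show ?thesis by simp
qed

text \<open>Since \<open>c > 0\<close>, a last part 1 would be a later part and have weight 0, so
  the bound on the last part removes nothing.\<close>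

lemma tail_sum_1: "0 < c \<Longrightarrow> \<psi> 1 = 0 \<Longrightarrow> tail_sum \<phi> \<psi> c 1 = comp_sum \<phi> \<psi> (c + 1)"
  using tail_sum_Suc[of c \<phi> \<psi> 0] by (simp add: tail_sum_0)

lemma tail_sum_2:
  "0 < c \<Longrightarrow> \<psi> 1 = 0 \<Longrightarrow>
    tail_sum \<phi> \<psi> c 2 = comp_sum \<phi> \<psi> (c + 2) - \<psi> 2 * comp_sum \<phi> \<psi> c"
  using tail_sum_Suc[of c \<phi> \<psi> 1] tail_sum_1[of "Suc c" \<psi> \<phi>] by (simp add: numeral_2_eq_2)

section \<open>The first partial sum that reaches a given bound\<close>

lemma comp_theta_append:
  assumes "J \<noteq> []" "c \<le> sum_list J" "sum_list J < c + last J"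
  shows "comp_theta (J @ K) c = sum_list J - c"
proof -
  let ?S = "{sum_list (take j (J @ K)) | j. j \<le> length (J @ K) \<and> c \<le> sum_list (take j (J @ K))}"
  have "?S \<subseteq> (\<lambda>j. sum_list (take j (J @ K))) ` {..length (J @ K)}"
    by auto
  then have fin: "finite ?S"
    by (rule finite_subset) simp
  have J: "J = butlast J @ [last J]" using assms(1) by simp
  have sumJ: "sum_list J = sum_list (butlast J) + last J"
    by (subst J) (simp del: append_butlast_last_id)
  have "Min ?S = sum_list J"
  proof (rule Min_eqI[OF fin])
    show "sum_list J \<in> ?S"
      using assms(2) by (auto intro!: exI[of _ "length J"])
    fix y assume "y \<in> ?S"
    then obtain j where y: "y = sum_list (take j (J @ K))" and c: "c \<le> y" by auto
    show "sum_list J \<le> y"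
    proof (cases "j < length J")
      case True
      \<comment> \<open>A proper prefix of \<open>J\<close> sums to at most
        \<open>sum_list J - last J\<close>, which is below \<open>c\<close> by the third assumption;
        so no earlier partial sum competes for the minimum.\<close>
      then have "take j (J @ K) = take j (butlast J)"
        by (simp add: take_butlast)
      moreover have "sum_list (take j (butlast J)) \<le> sum_list (butlast J)"
        by (metis append_take_drop_id le_add1 sum_list_append)
      ultimately show ?thesis
        using c y sumJ assms(3) by simp
    qed (simp add: y)
  qed
  then show ?thesis
    by (simp add: comp_theta_def comp_sigma_def)
qed

text \<open>\<open>J\<close> is the shortest prefix whose sum reaches \<open>c\<close>: the last
  inequality says that without its last part it falls short. The induction passes a first part
  \<open>i < c\<close> and continues with \<open>c - i\<close>.\<close>

lemma composition_split:
  fixes I :: "nat list"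
  assumes "0 < c" "c \<le> sum_list I"
  obtains J K where "I = J @ K" "J \<noteq> []" "c \<le> sum_list J" "sum_list J < c + last J"
proof -
  have "\<exists>J K. I = J @ K \<and> J \<noteq> [] \<and> c \<le> sum_list J \<and> sum_list J < c + last J"
    using assms
  proof (induction I arbitrary: c)
    case (Cons i I)
    show ?case
    proof (cases "c \<le> i")
      case True
      then show ?thesis using Cons.prems by (intro exI[of _ "[i]", OF exI[of _ I]]) auto
    next
      case False
      with Cons.prems have "0 < c - i" "c - i \<le> sum_list I" by auto
      from Cons.IH[OF this] obtain J K where
        "I = J @ K \<and> J \<noteq> [] \<and> c - i \<le> sum_list J \<and> sum_list J < c - i + last J" by blast
      then show ?thesis using False
        by (intro exI[of _ "i # J", OF exI[of _ K]]) auto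
    qed
  qed simp
  then show ?thesis using that by blast
qed

lemma sum_comp_theta_eq:
  fixes g :: "nat list \<Rightarrow> 'a :: comm_monoid_add"
  assumes "0 < c" "c + t \<le> n"
  shows "(\<Sum>I | I \<in> compositions n \<and> comp_theta I c = t. g I) =
    (\<Sum>J | J \<in> compositions (c + t) \<and> t < last J. \<Sum>K\<in>compositions (n - (c + t)). g (J @ K))"
proof -
  let ?A = "{J. J \<in> compositions (c + t) \<and> t < last J}"
  have J: "J \<noteq> []" "sum_list J = c + t" "\<forall>i\<in>set J. 1 \<le> i" "t < last J" if "J \<in> ?A" for J
    using that assms by (auto simp: compositions_def)
  \<comment> \<open>Of two prefixes of one list the longer exceeds the shorter by positive parts, so
    equal sums force them to coincide.\<close>
  have inj: "inj_on (\<lambda>(J, K). J @ K) (?A \<times> compositions (n - (c + t)))"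
  proof (rule inj_onI, clarify)
    fix J K J' K'
    assume A: "J \<in> compositions (c + t)" "J' \<in> compositions (c + t)" and "J @ K = J' @ K'"
    then consider us where "J = J' @ us" "K' = us @ K" | us where "J' = J @ us" "K = us @ K'"
      by (auto simp: append_eq_append_conv2)
    then show "J = J' \<and> K = K'"
    proof cases
      case 1
      with A have "us = []" by (cases us) (auto simp: compositions_def)
      with 1 show ?thesis by simp
    next
      case 2
      with A have "us = []" by (cases us) (auto simp: compositions_def)
      with 2 show ?thesis by simp
    qed
  qed
  have "{I. I \<in> compositions n \<and> comp_theta I c = t} =
      (\<lambda>(J, K). J @ K) ` (?A \<times> compositions (n - (c + t)))"
  proof (intro equalityI subsetI)
    fix I assume I: "I \<in> {I. I \<in> compositions n \<and> comp_theta I c = t}"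
    then have "c \<le> sum_list I" using assms by (auto simp: compositions_def)
    from composition_split[OF assms(1) this] obtain J K where
      JK: "I = J @ K" "J \<noteq> []" "c \<le> sum_list J" "sum_list J < c + last J" .
    with I comp_theta_append[OF JK(2-4), of K] have "sum_list J = c + t" by auto
    with I JK show "I \<in> (\<lambda>(J, K). J @ K) ` (?A \<times> compositions (n - (c + t)))"
      by (intro image_eqI[of _ _ "(J, K)"]) (auto simp: compositions_def)
  next
    fix I assume "I \<in> (\<lambda>(J, K). J @ K) ` (?A \<times> compositions (n - (c + t)))"
    then obtain J K where I: "I = J @ K" "J \<in> ?A" "K \<in> compositions (n - (c + t))" by auto
    from J[OF I(2)] have "comp_theta I c = t"
      unfolding I(1) by (subst comp_theta_append) auto
    with I assms show "I \<in> {I. I \<in> compositions n \<and> comp_theta I c = t}"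
      by (auto simp: compositions_def)
  qed
  then have "(\<Sum>I | I \<in> compositions n \<and> comp_theta I c = t. g I) =
      (\<Sum>(J, K)\<in>?A \<times> compositions (n - (c + t)). g (J @ K))"
    by (simp only: sum.reindex[OF inj]) (simp add: case_prod_unfold)
  then show ?thesis
    by (simp add: sum.cartesian_product)
qed

lemma comp_sum_theta_eq:
  assumes "0 < c" "c + t \<le> n"
  shows "(\<Sum>I | I \<in> compositions n \<and> comp_theta I c = t. comp_prod \<phi> \<psi> I) =
    tail_sum \<phi> \<psi> c t * comp_sum \<psi> \<psi> (n - (c + t))"
proof -
  have "(\<Sum>K\<in>compositions (n - (c + t)). comp_prod \<phi> \<psi> (J @ K)) =
      comp_prod \<phi> \<psi> J * comp_sum \<psi> \<psi> (n - (c + t))" if "J \<in> compositions (c + t)" for J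
    using compositions_nonempty[OF _ that] assms
    by (simp add: comp_prod_append comp_sum_def comp_prod_same sum_distrib_left)
  then show ?thesis
    by (simp add: sum_comp_theta_eq[OF assms] tail_sum_def sum_distrib_right)
qed

lemma sum_theta_le_2:
  fixes g :: "nat list \<Rightarrow> 'a :: comm_monoid_add"
  shows "(\<Sum>I | I \<in> compositions n \<and> comp_theta I c \<le> 2. g I) =
    (\<Sum>t\<in>{0,1,2}. \<Sum>I | I \<in> compositions n \<and> comp_theta I c = t. g I)"
proof -
  have "(\<Sum>I | I \<in> compositions n \<and> comp_theta I c \<le> 2. g I) =
    (\<Sum>t\<in>{0,1,2}. \<Sum>I | I \<in> {I. I \<in> compositions n \<and> comp_theta I c \<le> 2} \<and> comp_theta I c = t. g I)"
    by (rule sum.group[symmetric]) (auto simp: finite_compositions)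
  also have "\<dots> = (\<Sum>t\<in>{0,1,2}. \<Sum>I | I \<in> compositions n \<and> comp_theta I c = t. g I)"
    by (intro sum.cong refl) auto
  finally show ?thesis .
qed

text \<open>Complement of the three values 0, 1, 2. As \<open>\<psi> 1 = 0\<close>, only the value 2
  needs a correction, namely for prefixes that end with the part 2.\<close>

lemma comp_sum_theta_ge_3:
  assumes "0 < c" "c + 2 \<le> n" "\<psi> 1 = 0"
  shows "(\<Sum>I | I \<in> compositions n \<and> 3 \<le> comp_theta I c. comp_prod \<phi> \<psi> I) =
    comp_sum \<phi> \<psi> n - comp_sum \<phi> \<psi> c * comp_sum \<psi> \<psi> (n - c)
      - comp_sum \<phi> \<psi> (c + 1) * comp_sum \<psi> \<psi> (n - (c + 1))
      - (comp_sum \<phi> \<psi> (c + 2) - \<psi> 2 * comp_sum \<phi> \<psi> c) * comp_sum \<psi> \<psi> (n - (c + 2))"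
proof -
  let ?G = "{I. I \<in> compositions n \<and> 3 \<le> comp_theta I c}"
  let ?L = "{I. I \<in> compositions n \<and> comp_theta I c \<le> 2}"
  have "comp_sum \<phi> \<psi> n = sum (comp_prod \<phi> \<psi>) (?G \<union> ?L)"
    unfolding comp_sum_def by (rule sum.cong) auto
  also have "\<dots> = sum (comp_prod \<phi> \<psi>) ?G + sum (comp_prod \<phi> \<psi>) ?L"
    by (rule sum.union_disjoint) (auto simp: finite_compositions)
  also have "sum (comp_prod \<phi> \<psi>) ?L =
      comp_sum \<phi> \<psi> c * comp_sum \<psi> \<psi> (n - c)
      + comp_sum \<phi> \<psi> (c + 1) * comp_sum \<psi> \<psi> (n - (c + 1))
      + (comp_sum \<phi> \<psi> (c + 2) - \<psi> 2 * comp_sum \<phi> \<psi> c) * comp_sum \<psi> \<psi> (n - (c + 2))"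
    using assms
    by (simp add: sum_theta_le_2 comp_sum_theta_eq tail_sum_0 tail_sum_1 tail_sum_2 del: One_nat_def)
  finally show ?thesis
    by (simp add: algebra_simps)
qed

section \<open>The chromatic symmetric function of a path\<close>

definition weighted_sum :: "'b set \<Rightarrow> ('b \<Rightarrow> monom) \<Rightarrow> ('b \<Rightarrow> 'a :: comm_ring_1) \<Rightarrow> 'a mps" where
  "weighted_sum A \<mu> f = Abs_mps (\<lambda>m. \<Sum>a | a \<in> A \<and> \<mu> a = m. f a)"

definition finite_fibres :: "'b set \<Rightarrow> ('b \<Rightarrow> monom) \<Rightarrow> bool" where
  "finite_fibres A \<mu> \<longleftrightarrow> (\<forall>m. finite {a \<in> A. \<mu> a = m})"

lemma coeff_weighted_sum:
  "mps_coeff (weighted_sum A \<mu> f) m = (\<Sum>a | a \<in> A \<and> \<mu> a = m. f a)"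
  by (simp add: weighted_sum_def Abs_mps_inverse)

lemma monom_sum_eq_weighted_sum: "monom_sum A \<mu> = weighted_sum A \<mu> (\<lambda>_. 1)"
  by (rule mps_eqI) (simp add: coeff_weighted_sum monom_sum.rep_eq)

lemma finite_fibresD: "finite_fibres A \<mu> \<Longrightarrow> finite {a \<in> A. \<mu> a = m}"
  by (simp add: finite_fibres_def)

lemma finite_fibres_subset: "finite_fibres B \<mu> \<Longrightarrow> A \<subseteq> B \<Longrightarrow> finite_fibres A \<mu>"
  unfolding finite_fibres_def by (auto intro: finite_subset[rotated])

lemma finite_fibres_Times:
  assumes "finite_fibres A \<mu>" "finite_fibres B \<nu>"
  shows "finite_fibres (A \<times> B) (\<lambda>(a, b). \<mu> a + \<nu> b)"
  unfolding finite_fibres_def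
proof
  fix m
  have "{p \<in> A \<times> B. (case p of (a, b) \<Rightarrow> \<mu> a + \<nu> b) = m} \<subseteq>
      (\<Union>q\<in>{q. fst q + snd q = m}. {a \<in> A. \<mu> a = fst q} \<times> {b \<in> B. \<nu> b = snd q})"
    by auto
  then show "finite {p \<in> A \<times> B. (case p of (a, b) \<Rightarrow> \<mu> a + \<nu> b) = m}"
    by (rule finite_subset)
      (intro finite_UN_I finite_monom_splits finite_cartesian_product
        finite_fibresD[OF assms(1)] finite_fibresD[OF assms(2)])
qed

lemma weighted_sum_cong:
  "(\<And>a. a \<in> A \<Longrightarrow> f a = g a) \<Longrightarrow> weighted_sum A \<mu> f = weighted_sum A \<mu> g"
  by (intro mps_eqI) (auto simp: coeff_weighted_sum intro!: sum.cong)

text \<open>Finite fibres need not be assumed: over an infinite fibre all three sums take the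
  default value 0.\<close>

lemma weighted_sum_add:
  "weighted_sum A \<mu> (\<lambda>a. f a + g a) = weighted_sum A \<mu> f + weighted_sum A \<mu> g"
  by (rule mps_eqI) (simp add: coeff_weighted_sum plus_mps.rep_eq sum.distrib)

lemma weighted_sum_diff:
  "weighted_sum A \<mu> (\<lambda>a. f a - g a) = weighted_sum A \<mu> f - weighted_sum A \<mu> g"
  by (rule mps_eqI) (simp add: coeff_weighted_sum minus_mps.rep_eq sum_subtractf)

lemma weighted_sum_0: "weighted_sum A \<mu> (\<lambda>a. 0) = 0"
  by (rule mps_eqI) (simp add: coeff_weighted_sum zero_mps.rep_eq)

lemma weighted_sum_of_nat_cmult:
  "weighted_sum A \<mu> (\<lambda>a. of_nat k * f a) = of_nat k * weighted_sum A \<mu> f"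
  by (induction k) (simp_all add: weighted_sum_add weighted_sum_0 distrib_right)

lemma weighted_sum_reindex:
  assumes "bij_betw h A B" "\<And>a. a \<in> A \<Longrightarrow> \<mu> a = \<nu> (h a)" "\<And>a. a \<in> A \<Longrightarrow> f a = g (h a)"
  shows "weighted_sum A \<mu> f = weighted_sum B \<nu> g"
proof (rule mps_eqI)
  fix m
  have "bij_betw h {a \<in> A. \<mu> a = m} {b \<in> B. \<nu> b = m}"
    using assms(1,2) by (auto simp: bij_betw_def inj_on_def)
  from sum.reindex_bij_betw[OF this, of g]
  show "mps_coeff (weighted_sum A \<mu> f) m = mps_coeff (weighted_sum B \<nu> g) m"
    by (simp add: coeff_weighted_sum assms(3) flip: sum.inter_filter)
qed

text \<open>Pairs with a fixed total monomial are grouped by the pair of their monomials. A monomial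
  has finitely many splittings, so finite fibres of the factors make this a finite
  regrouping.\<close>

lemma weighted_sum_mult:
  assumes "finite_fibres A \<mu>" "finite_fibres B \<nu>"
  shows "weighted_sum A \<mu> f * weighted_sum B \<nu> g =
    weighted_sum (A \<times> B) (\<lambda>(a, b). \<mu> a + \<nu> b) (\<lambda>(a, b). f a * g b)"
proof (rule mps_eqI)
  fix m
  let ?S = "{q. fst q + snd q = m}" and ?P = "{p \<in> A \<times> B. (case p of (a, b) \<Rightarrow> \<mu> a + \<nu> b) = m}"
  have "mps_coeff (weighted_sum A \<mu> f * weighted_sum B \<nu> g) m =
      (\<Sum>q\<in>?S. \<Sum>(a, b)\<in>{a \<in> A. \<mu> a = fst q} \<times> {b \<in> B. \<nu> b = snd q}. f a * g b)"
    unfolding times_mps.rep_eq coeff_weighted_sum sum_product sum.cartesian_product ..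
  also have "\<dots> = (\<Sum>q\<in>?S. \<Sum>p | p \<in> ?P \<and> (\<mu> (fst p), \<nu> (snd p)) = q. (\<lambda>(a, b). f a * g b) p)"
  proof (rule sum.cong[OF refl])
    fix q assume "q \<in> ?S"
    then have q: "fst q + snd q = m" by simp
    have "{a \<in> A. \<mu> a = fst q} \<times> {b \<in> B. \<nu> b = snd q} =
        {p \<in> A \<times> B. (case p of (a, b) \<Rightarrow> \<mu> a + \<nu> b) = fst q + snd q \<and> (\<mu> (fst p), \<nu> (snd p)) = q}"
      by auto
    then have "{a \<in> A. \<mu> a = fst q} \<times> {b \<in> B. \<nu> b = snd q} = {p. p \<in> ?P \<and> (\<mu> (fst p), \<nu> (snd p)) = q}"
      unfolding q by blast
    then show "(\<Sum>(a, b)\<in>{a \<in> A. \<mu> a = fst q} \<times> {b \<in> B. \<nu> b = snd q}. f a * g b) =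
        (\<Sum>p | p \<in> ?P \<and> (\<mu> (fst p), \<nu> (snd p)) = q. (\<lambda>(a, b). f a * g b) p)"
      by (simp only:)
  qed
  also have "\<dots> = (\<Sum>p\<in>?P. (\<lambda>(a, b). f a * g b) p)"
    by (rule sum.group)
      (use finite_fibresD[OF finite_fibres_Times[OF assms], of m] finite_monom_splits in auto)
  finally show "mps_coeff (weighted_sum A \<mu> f * weighted_sum B \<nu> g) m =
      mps_coeff (weighted_sum (A \<times> B) (\<lambda>(a, b). \<mu> a + \<nu> b) (\<lambda>(a, b). f a * g b)) m"
    by (simp add: coeff_weighted_sum)
qed

lemma weighted_sum_of_bool:
  assumes "finite_fibres A \<mu>"
  shows "weighted_sum A \<mu> (\<lambda>a. of_bool (P a) * f a) = weighted_sum {a \<in> A. P a} \<mu> f"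
proof (rule mps_eqI)
  fix m
  have "(\<Sum>a | a \<in> A \<and> \<mu> a = m. of_bool (P a) * f a) =
      (\<Sum>a | a \<in> {a \<in> A. P a} \<and> \<mu> a = m. of_bool (P a) * f a)"
    by (rule sum.mono_neutral_right) (use finite_fibresD[OF assms, of m] in auto)
  then show "mps_coeff (weighted_sum A \<mu> (\<lambda>a. of_bool (P a) * f a)) m =
      mps_coeff (weighted_sum {a \<in> A. P a} \<mu> f) m"
    by (simp add: coeff_weighted_sum)
qed

text \<open>A decoration \<open>b\<close> that does not enter the monomial only multiplies the
  count; this turns a count of preimages into a weight.\<close>

lemma weighted_sum_Sigma:
  assumes "finite_fibres A \<mu>" "\<And>a. a \<in> A \<Longrightarrow> finite (B a)"
  shows "weighted_sum (Sigma A B) (\<lambda>(a, b). \<mu> a) (\<lambda>_. 1) = weighted_sum A \<mu> (\<lambda>a. of_nat (card (B a)))"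
proof (rule mps_eqI)
  fix m
  have "(\<Sum>p | p \<in> Sigma A B \<and> (case p of (a, b) \<Rightarrow> \<mu> a) = m. 1 :: 'c) =
      (\<Sum>p\<in>Sigma {a \<in> A. \<mu> a = m} B. 1)"
    by (rule sum.cong) auto
  also have "\<dots> = (\<Sum>a\<in>{a \<in> A. \<mu> a = m}. \<Sum>b\<in>B a. 1)"
    by (subst sum.Sigma) (use finite_fibresD[OF assms(1)] assms(2) in auto)
  finally show "mps_coeff (weighted_sum (Sigma A B) (\<lambda>(a, b). \<mu> a) (\<lambda>_. 1 :: 'c)) m =
      mps_coeff (weighted_sum A \<mu> (\<lambda>a. of_nat (card (B a)))) m"
    by (simp add: coeff_weighted_sum)
qed

section \<open>Colorings of paths as words\<close>

definition list_monom :: "nat list \<Rightarrow> monom" where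
  "list_monom xs = (\<Sum>c\<leftarrow>xs. Poly_Mapping.single c 1)"

definition set_monom :: "nat set \<Rightarrow> monom" where
  "set_monom S = (\<Sum>c\<in>S. Poly_Mapping.single c 1)"

definition color_sets :: "nat \<Rightarrow> nat set set" where
  "color_sets k = {S. S \<subseteq> {1..} \<and> finite S \<and> card S = k}"

definition words :: "nat \<Rightarrow> nat list set" where
  "words n = {xs. length xs = n \<and> set xs \<subseteq> {1..}}"

definition path_words :: "nat \<Rightarrow> nat list set" where
  "path_words n = {xs \<in> words n. distinct_adj xs}"

text \<open>Read along the path, a proper coloring is a word without equal neighbours, so this is
  the chromatic symmetric function of the path with \<open>n\<close> vertices; for
  \<open>n = 0\<close> it is 1.\<close>

definition path_sf :: "nat \<Rightarrow> 'a :: comm_ring_1 mps" where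
  "path_sf n = weighted_sum (path_words n) list_monom (\<lambda>_. 1)"

lemma list_monom_simps [simp]:
  "list_monom [] = 0"
  "list_monom (c # xs) = Poly_Mapping.single c 1 + list_monom xs"
  "list_monom (xs @ ys) = list_monom xs + list_monom ys"
  by (simp_all add: list_monom_def)

lemma keys_add_monom: "Poly_Mapping.keys (a + b :: monom) = Poly_Mapping.keys a \<union> Poly_Mapping.keys b"
  by (auto simp: in_keys_iff lookup_add)

lemma keys_list_monom: "Poly_Mapping.keys (list_monom xs) = set xs"
  by (induction xs) (auto simp: keys_add_monom)

lemma finite_fibres_words: "finite_fibres (words n) list_monom"
  unfolding finite_fibres_def
proof
  fix m
  have "{xs \<in> words n. list_monom xs = m} \<subseteq> {xs. set xs \<subseteq> Poly_Mapping.keys m \<and> length xs = n}"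
    by (auto simp: words_def keys_list_monom)
  then show "finite {xs \<in> words n. list_monom xs = m}"
    by (rule finite_subset) (simp add: finite_lists_length_eq)
qed

lemma finite_fibres_path_words: "finite_fibres (path_words n) list_monom"
  by (rule finite_fibres_subset[OF finite_fibres_words]) (auto simp: path_words_def)

lemma finite_fibres_color_sets: "finite_fibres (color_sets k) set_monom"
  unfolding finite_fibres_def color_sets_def set_monom_def
  using finite_esym_fibre by blast

lemma esym_eq: "esym k = weighted_sum (color_sets k) set_monom (\<lambda>_. 1)"
  by (simp add: esym_def monom_sum_eq_weighted_sum color_sets_def set_monom_def[abs_def])

section \<open>The path recursion through marked words\<close>

definition marked_words :: "nat \<Rightarrow> nat \<Rightarrow> (nat set \<times> nat list) set" where
  "marked_words k n = color_sets k \<times> path_words n"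

definition marked_monom :: "nat set \<times> nat list \<Rightarrow> monom" where
  "marked_monom = (\<lambda>(S, xs). set_monom S + list_monom xs)"

text \<open>The empty word counts as free, so that the recursion ends in
  \<open>free_sf k 0 = esym k\<close>.\<close>

definition free_head :: "nat set \<times> nat list \<Rightarrow> bool" where
  "free_head = (\<lambda>(S, xs). xs = [] \<or> hd xs \<notin> S)"

text \<open>
  Moving the head of a word into the set \<open>S\<close> turns a pair with \<open>hd xs \<notin> S\<close> into one whose set is larger
  and whose word is shorter; counting preimages gives the recursion below, which interpolates between
  \<open>path_sf n\<close> and \<open>esym n\<close>.
\<close>

definition free_sf :: "nat \<Rightarrow> nat \<Rightarrow> 'a :: comm_ring_1 mps" where
  "free_sf k n = weighted_sum {p \<in> marked_words k n. free_head p} marked_monom (\<lambda>_. 1)"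

lemma finite_fibres_marked: "finite_fibres (marked_words k n) marked_monom"
  unfolding marked_words_def marked_monom_def
  by (intro finite_fibres_Times finite_fibres_color_sets finite_fibres_path_words)

lemma esym_path_sf: "esym k * path_sf n = weighted_sum (marked_words k n) marked_monom (\<lambda>_. 1)"
  unfolding esym_eq path_sf_def marked_words_def marked_monom_def
  by (subst weighted_sum_mult) (simp_all add: finite_fibres_color_sets finite_fibres_path_words case_prod_unfold)

lemma path_words_Suc_iff:
  "c # xs \<in> path_words (Suc n) \<longleftrightarrow> 1 \<le> c \<and> xs \<in> path_words n \<and> (xs = [] \<or> c \<noteq> hd xs)"
  by (auto simp: path_words_def words_def distinct_adj_Cons)

lemma path_words_0: "path_words 0 = {[]}"
  by (auto simp: path_words_def words_def)

lemma color_sets_0: "color_sets 0 = {{}}"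
  by (auto simp: color_sets_def)

lemma free_sf_Suc:
  "free_sf k (Suc n) = of_nat k * (esym (Suc k) * path_sf n) + (free_sf (Suc k) n :: 'a :: comm_ring_1 mps)"
proof -
  \<comment> \<open>\<open>B (S, xs)\<close> holds the letters of \<open>S\<close> that may be moved
    back in front of \<open>xs\<close>: all \<open>k + 1\<close> of them if the head is free, all
    except \<open>hd xs\<close> otherwise.\<close>
  define B where "B = (\<lambda>(S, xs :: nat list). {c \<in> S. xs = [] \<or> c \<noteq> hd xs})"
  have card_B: "card (B p) = k + of_bool (free_head p)" and fin_B: "finite (B p)"
    if "p \<in> marked_words (Suc k) n" for p
  proof -
    obtain S xs where p: "p = (S, xs)" by fastforce
    with that have S: "finite S" "card S = Suc k" by (auto simp: marked_words_def color_sets_def)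
    show "finite (B p)" using S by (simp add: B_def p)
    show "card (B p) = k + of_bool (free_head p)"
    proof (cases "free_head p")
      case True
      then have "B p = S" by (auto simp: B_def p free_head_def)
      with True S show ?thesis by simp
    next
      case False
      then have "B p = S - {hd xs}" "hd xs \<in> S" by (auto simp: B_def p free_head_def)
      with False S show ?thesis by simp
    qed
  qed
  have "free_sf k (Suc n) =
      weighted_sum (Sigma (marked_words (Suc k) n) B) (\<lambda>(p, c). marked_monom p) (\<lambda>_. 1 :: 'a)"
    unfolding free_sf_def
  proof (rule weighted_sum_reindex)
    \<comment> \<open>The moved letter is recorded as a third entry, which makes the move
      reversible; being free, it lies outside \<open>S\<close>, so the set really grows to
      \<open>k + 1\<close> elements.\<close>
    show "bij_betw (\<lambda>(S, xs). ((insert (hd xs) S, tl xs), hd xs))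
        {p \<in> marked_words k (Suc n). free_head p} (Sigma (marked_words (Suc k) n) B)"
    proof (rule bij_betw_byWitness[where f' = "\<lambda>((S, xs), c). (S - {c}, c # xs)"])
      show "\<forall>p\<in>{p \<in> marked_words k (Suc n). free_head p}.
          (case case p of (S, xs) \<Rightarrow> ((insert (hd xs) S, tl xs), hd xs) of
            (x, xa) \<Rightarrow> (case x of (S, xs) \<Rightarrow> \<lambda>c. (S - {c}, c # xs)) xa) = p"
        by (auto simp: marked_words_def free_head_def path_words_def words_def length_Suc_conv)
      show "\<forall>q\<in>Sigma (marked_words (Suc k) n) B.
          (case case q of (x, xa) \<Rightarrow> (case x of (S, xs) \<Rightarrow> \<lambda>c. (S - {c}, c # xs)) xa of
            (S, xs) \<Rightarrow> ((insert (hd xs) S, tl xs), hd xs)) = q"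
        by (auto simp: B_def)
      show "(\<lambda>(S, xs). ((insert (hd xs) S, tl xs), hd xs)) `
          {p \<in> marked_words k (Suc n). free_head p} \<subseteq> Sigma (marked_words (Suc k) n) B"
      proof (rule image_subsetI)
        fix p assume A: "p \<in> {p \<in> marked_words k (Suc n). free_head p}"
        then obtain S c ys where p: "p = (S, c # ys)"
          by (auto simp: marked_words_def path_words_def words_def length_Suc_conv)
        from A show "(case p of (S, xs) \<Rightarrow> ((insert (hd xs) S, tl xs), hd xs)) \<in>
            Sigma (marked_words (Suc k) n) B"
          unfolding p
          by (auto simp: marked_words_def path_words_Suc_iff free_head_def B_def color_sets_def)
      qed
      show "(\<lambda>((S, xs), c). (S - {c}, c # xs)) ` Sigma (marked_words (Suc k) n) B
          \<subseteq> {p \<in> marked_words k (Suc n). free_head p}"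
        by (auto simp: marked_words_def path_words_Suc_iff free_head_def B_def color_sets_def)
    qed
  next
    fix p assume "p \<in> {p \<in> marked_words k (Suc n). free_head p}"
    then obtain S c xs where p: "p = (S, c # xs)" "finite S" "c \<notin> S"
      by (auto simp: marked_words_def color_sets_def free_head_def path_words_def words_def length_Suc_conv)
    then show "marked_monom p =
        (case case p of (S, xs) \<Rightarrow> ((insert (hd xs) S, tl xs), hd xs) of (p, c) \<Rightarrow> marked_monom p)"
      by (simp add: marked_monom_def set_monom_def add_ac)
  qed simp
  also have "\<dots> = weighted_sum (marked_words (Suc k) n) marked_monom (\<lambda>p. of_nat (card (B p)))"
    by (rule weighted_sum_Sigma[OF finite_fibres_marked]) (rule fin_B)
  \<comment> \<open>The summand \<open>k\<close> counts all marked words and gives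
    \<open>esym (Suc k) * path_sf n\<close>; the indicator restricts to the free ones. The factors 1
    match the scaling and restriction rules.\<close>
  also have "\<dots> = weighted_sum (marked_words (Suc k) n) marked_monom
      (\<lambda>p. of_nat k * 1 + of_bool (free_head p) * 1)"
    by (rule weighted_sum_cong) (simp add: card_B)
  also have "\<dots> = of_nat k * (esym (Suc k) * path_sf n) + free_sf (Suc k) n"
    unfolding weighted_sum_add weighted_sum_of_nat_cmult esym_path_sf
      weighted_sum_of_bool[OF finite_fibres_marked] free_sf_def ..
  finally show ?thesis .
qed

lemma weighted_sum_singleton: "\<mu> a = 0 \<Longrightarrow> weighted_sum {a} \<mu> (\<lambda>_. 1) = 1"
proof (rule mps_eqI)
  fix m
  assume "\<mu> a = 0"
  then have "{x. x \<in> {a} \<and> \<mu> x = m} = (if m = 0 then {a} else {})" by auto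
  then show "mps_coeff (weighted_sum {a} \<mu> (\<lambda>_. 1)) m = mps_coeff 1 m"
    by (simp add: coeff_weighted_sum one_mps.rep_eq)
qed

lemma path_sf_0 [simp]: "path_sf 0 = 1"
  by (simp add: path_sf_def path_words_0 weighted_sum_singleton)

lemma esym_0 [simp]: "esym 0 = 1"
  by (simp add: esym_eq color_sets_0 weighted_sum_singleton set_monom_def)

lemma free_sf_0_right: "free_sf k 0 = esym k"
proof -
  have "{p \<in> marked_words k 0. free_head p} = marked_words k 0"
    by (auto simp: marked_words_def path_words_0 free_head_def)
  then show ?thesis
    unfolding free_sf_def by (simp flip: esym_path_sf)
qed

lemma free_sf_0_left: "free_sf 0 n = path_sf n"
proof -
  have "{p \<in> marked_words 0 n. free_head p} = marked_words 0 n"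
    by (auto simp: marked_words_def color_sets_0 free_head_def)
  then show ?thesis
    unfolding free_sf_def by (simp flip: esym_path_sf)
qed

text \<open>\<open>free_sf_Suc\<close> unrolled \<open>n\<close> times. At \<open>k = 0\<close> the
  left side is \<open>path_sf n\<close>, and the sum is a recursion for it.\<close>

lemma free_sf_eq:
  "free_sf k n = (\<Sum>i<n. of_nat (k + i) * (esym (k + i + 1) * path_sf (n - 1 - i))) + esym (k + n)"
proof (induction n arbitrary: k)
  case 0
  then show ?case by (simp add: free_sf_0_right)
next
  case (Suc n)
  have eq: "(\<Sum>i<Suc n. of_nat (k + i) * (esym (k + i + 1) * path_sf (Suc n - 1 - i))) =
      of_nat k * (esym (Suc k) * path_sf n) +
      (\<Sum>i<n. of_nat (Suc k + i) * (esym (Suc k + i + 1) * path_sf (n - 1 - i)))"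
    by (subst sum.lessThan_Suc_shift) simp
  show ?case
    unfolding free_sf_Suc Suc.IH eq by (simp only: add.assoc add_Suc add_Suc_right)
qed

definition e_first :: "nat \<Rightarrow> 'a :: comm_ring_1 mps" where
  "e_first k = of_nat k * esym k"

definition e_later :: "nat \<Rightarrow> 'a :: comm_ring_1 mps" where
  "e_later k = of_nat (k - 1) * esym k"

lemma path_sf_eq_comp_sum: "path_sf n = comp_sum e_first e_later n"
proof (induction n rule: less_induct)
  case (less n)
  let ?S = "comp_sum e_first e_later :: nat \<Rightarrow> 'a mps"
  show ?case
  proof (cases "n = 0")
    case False
    have "path_sf n = (\<Sum>i<n. of_nat i * (esym (i + 1) * ?S (n - 1 - i))) + esym n"
      unfolding trans[OF free_sf_0_left[symmetric] free_sf_eq[of 0 n]]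
      by (intro arg_cong2[of _ _ _ _ "(+)"] sum.cong refl) (simp_all add: less)
    also have "\<dots> = (\<Sum>j=1..n. of_nat (j - 1) * esym j * ?S (n - j)) + esym n"
      by (simp add: sum.atLeast1_atMost_eq mult.assoc)
    \<comment> \<open>The term \<open>j = n\<close> is \<open>(n - 1) * e_n\<close>, because
      \<open>comp_sum\<close> is 1 at 0; with the extra \<open>e_n\<close> it becomes
      \<open>n * e_n\<close>, the weight of a single first part.\<close>
    also have "\<dots> = (\<Sum>j=1..<n. of_nat (j - 1) * esym j * ?S (n - j)) + of_nat n * esym n"
      using False by (subst sum.last_plus) (auto simp: of_nat_diff algebra_simps)
    also have "\<dots> = ?S n"
      using False by (subst (2) comp_sum_rec) (simp_all add: e_first_def e_later_def)
    finally show ?thesis .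
  qed simp
qed

section \<open>Twins of paths\<close>

text \<open>\<open>u\<close> and \<open>w\<close> color the path left and right of the twins,
  \<open>p\<close> the new vertex and \<open>q\<close> the vertex \<open>l\<close>. No condition
  links the four entries; such conditions come from the predicate in
  \<open>twin_sum\<close>.\<close>

definition twin_words :: "nat \<Rightarrow> nat \<Rightarrow> (nat list \<times> nat \<times> nat \<times> nat list) set" where
  "twin_words a b = path_words a \<times> {1..} \<times> {1..} \<times> path_words b"

definition twin_monom :: "nat list \<times> nat \<times> nat \<times> nat list \<Rightarrow> monom" where
  "twin_monom = (\<lambda>(u, p, q, w). list_monom (u @ [p, q] @ w))"

text \<open>With one index set for all predicates, an identity between indicator functions lifts
  termwise to an identity of power series.\<close>

definition twin_sum :: "nat \<Rightarrow> nat \<Rightarrow> (nat list \<times> nat \<times> nat \<times> nat list \<Rightarrow> bool) \<Rightarrow> 'a :: comm_ring_1 mps" where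
  "twin_sum a b P = weighted_sum (twin_words a b) twin_monom (\<lambda>x. of_bool (P x))"

lemma finite_fibres_inj:
  assumes "finite_fibres B \<nu>" "inj_on h A" "h ` A \<subseteq> B" "\<And>a. a \<in> A \<Longrightarrow> \<mu> a = \<nu> (h a)"
  shows "finite_fibres A \<mu>"
  unfolding finite_fibres_def
proof
  fix m
  have "h ` {a \<in> A. \<mu> a = m} \<subseteq> {b \<in> B. \<nu> b = m}"
    using assms(3,4) by auto
  then have "finite (h ` {a \<in> A. \<mu> a = m})"
    by (rule finite_subset) (rule finite_fibresD[OF assms(1)])
  then show "finite {a \<in> A. \<mu> a = m}"
    by (rule finite_imageD) (rule inj_on_subset[OF assms(2)], auto)
qed

lemma finite_fibres_twin_words: "finite_fibres (twin_words a b) twin_monom"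
proof (rule finite_fibres_inj[OF finite_fibres_words[of "a + b + 2"]])
  show "inj_on (\<lambda>(u, p, q, w). u @ [p, q] @ w) (twin_words a b)"
    by (auto simp: inj_on_def twin_words_def path_words_def words_def)
  show "(\<lambda>(u, p, q, w). u @ [p, q] @ w) ` twin_words a b \<subseteq> words (a + b + 2)"
    by (auto simp: twin_words_def path_words_def words_def)
qed (auto simp: twin_monom_def)

lemma twin_sum_eq: "twin_sum a b P = weighted_sum {x \<in> twin_words a b. P x} twin_monom (\<lambda>_. 1)"
  using weighted_sum_of_bool[OF finite_fibres_twin_words, of a b P "\<lambda>_. 1"] by (simp add: twin_sum_def)

text \<open>Exchanging \<open>p\<close> and \<open>q\<close> preserves the monomial.\<close>

lemma twin_sum_swap: "twin_sum a b (\<lambda>(u, p, q, w). P u p q w) = twin_sum a b (\<lambda>(u, p, q, w). P u q p w)"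
  unfolding twin_sum_def
proof (rule weighted_sum_reindex)
  show "bij_betw (\<lambda>(u, p, q, w). (u, q, p, w)) (twin_words a b) (twin_words a b)"
    by (rule bij_betw_byWitness[where f' = "\<lambda>(u, p, q, w). (u, q, p, w)"]) (auto simp: twin_words_def)
qed (auto simp: twin_monom_def add_ac)

section \<open>Products of path functions as sums over twin words\<close>

lemma path_words_append_iff:
  "length u = a \<Longrightarrow> u @ v \<in> path_words (a + m) \<longleftrightarrow>
    u \<in> path_words a \<and> v \<in> path_words m \<and> (u = [] \<or> v = [] \<or> last u \<noteq> hd v)"
  by (auto simp: path_words_def words_def distinct_adj_append_iff)

lemma path_words_split:
  assumes "xs \<in> path_words (a + m)"
  obtains u v where "xs = u @ v" "u \<in> path_words a" "v \<in> path_words m" "u = [] \<or> v = [] \<or> last u \<noteq> hd v"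
proof -
  from assms have "length (take a xs) = a" by (simp add: path_words_def words_def)
  from path_words_append_iff[OF this, of "drop a xs" m] assms that[of "take a xs" "drop a xs"]
  show ?thesis by simp
qed

lemma path_words_Nil_iff [simp]: "[] \<in> path_words m \<longleftrightarrow> m = 0"
  by (auto simp: path_words_def words_def)

lemma path_words_Suc_cases:
  assumes "xs \<in> path_words (Suc m)"
  obtains c v where "xs = c # v" "1 \<le> c" "v \<in> path_words m" "v = [] \<or> c \<noteq> hd v"
proof (cases xs)
  case (Cons c v)
  with assms that[of c v] show ?thesis by (auto simp: path_words_Suc_iff)
qed (use assms in simp)

lemma path_words_Suc_snoc_iff:
  "u @ [c] \<in> path_words (Suc m) \<longleftrightarrow> 1 \<le> c \<and> u \<in> path_words m \<and> (u = [] \<or> last u \<noteq> c)"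
  by (auto simp: path_words_def words_def distinct_adj_append_iff)

lemma path_words_length: "u \<in> path_words a \<Longrightarrow> length u = a"
  by (simp add: path_words_def words_def)

lemma path_words_append_inject:
  "u \<in> path_words a \<Longrightarrow> u' \<in> path_words a \<Longrightarrow> u @ v = u' @ v' \<longleftrightarrow> u = u' \<and> v = v'"
  by (simp add: path_words_def words_def)

text \<open>The predicate lists the edges added between the pieces; here they form the single path
  \<open>u, p, q, w\<close>. Positive \<open>a\<close> and \<open>b\<close> make
  \<open>last u\<close> and \<open>hd w\<close> genuine letters.\<close>

lemma path_sf_eq_twin_sum:
  assumes "0 < a" "0 < b"
  shows "path_sf (a + b + 2) = twin_sum a b (\<lambda>(u, p, q, w). last u \<noteq> p \<and> p \<noteq> q \<and> q \<noteq> hd w)"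
  unfolding path_sf_def twin_sum_eq
proof (rule weighted_sum_reindex[symmetric])
  show "bij_betw (\<lambda>(u, p, q, w). u @ p # q # w)
      {x \<in> twin_words a b. case x of (u, p, q, w) \<Rightarrow> last u \<noteq> p \<and> p \<noteq> q \<and> q \<noteq> hd w}
      (path_words (a + b + 2))" (is "bij_betw ?f ?A _")
  proof (rule bij_betwI')
    fix x y assume "x \<in> ?A" "y \<in> ?A"
    then show "(?f x = ?f y) = (x = y)"
      by (auto simp: twin_words_def path_words_append_inject)
  next
    fix x assume "x \<in> ?A"
    with assms show "?f x \<in> path_words (a + b + 2)"
      using path_words_append_iff[of "fst x" a _ "b + 2"]
      by (auto simp: twin_words_def path_words_Suc_iff path_words_length)
  next
    fix xs assume "xs \<in> path_words (a + b + 2)"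
    then have "xs \<in> path_words (a + Suc (Suc b))" by simp
    then show "\<exists>x\<in>?A. xs = ?f x"
      using assms
      by (elim path_words_split path_words_Suc_cases) (auto simp: twin_words_def)
  qed
qed (auto simp: twin_monom_def)

lemma path_sf_mult:
  "path_sf m * path_sf n =
    weighted_sum (path_words m \<times> path_words n) (\<lambda>(u, v). list_monom u + list_monom v) (\<lambda>_. 1)"
  unfolding path_sf_def
  by (subst weighted_sum_mult) (simp_all add: finite_fibres_path_words case_prod_unfold)

text \<open>Here \<open>q\<close> is an isolated vertex beside the path
  \<open>u, p, w\<close>.\<close>

lemma path_sf_1_mult_eq_twin_sum:
  assumes "0 < a" "0 < b"
  shows "path_sf 1 * path_sf (a + b + 1) = twin_sum a b (\<lambda>(u, p, q, w). last u \<noteq> p \<and> p \<noteq> hd w)"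
  unfolding path_sf_mult twin_sum_eq
proof (rule weighted_sum_reindex[symmetric])
  show "bij_betw (\<lambda>(u, p, q, w). ([q], u @ p # w))
      {x \<in> twin_words a b. case x of (u, p, q, w) \<Rightarrow> last u \<noteq> p \<and> p \<noteq> hd w}
      (path_words 1 \<times> path_words (a + b + 1))" (is "bij_betw ?f ?A _")
  proof (rule bij_betwI')
    fix x y assume "x \<in> ?A" "y \<in> ?A"
    then show "(?f x = ?f y) = (x = y)"
      by (auto simp: twin_words_def path_words_append_inject)
  next
    fix x assume "x \<in> ?A"
    with assms show "?f x \<in> path_words 1 \<times> path_words (a + b + 1)"
      using path_words_append_iff[of "fst x" a _ "b + 1"]
      by (auto simp: twin_words_def path_words_Suc_iff path_words_length)
  next
    fix y assume "y \<in> path_words 1 \<times> path_words (a + b + 1)"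
    then have "fst y \<in> path_words (Suc 0)" "snd y \<in> path_words (a + Suc b)" by auto
    then show "\<exists>x\<in>?A. y = ?f x"
      using assms
      by (elim path_words_split path_words_Suc_cases)
        (cases y, auto simp: twin_words_def path_words_0)
  qed
qed (auto simp: twin_monom_def add_ac)

text \<open>The path \<open>u, p, q, w\<close> cut between the twins.\<close>

lemma path_sf_mult_eq_twin_sum_middle:
  assumes "0 < a" "0 < b"
  shows "path_sf (a + 1) * path_sf (b + 1) = twin_sum a b (\<lambda>(u, p, q, w). last u \<noteq> p \<and> q \<noteq> hd w)"
  unfolding path_sf_mult twin_sum_eq
proof (rule weighted_sum_reindex[symmetric])
  show "bij_betw (\<lambda>(u, p, q, w). (u @ [p], q # w))
      {x \<in> twin_words a b. case x of (u, p, q, w) \<Rightarrow> last u \<noteq> p \<and> q \<noteq> hd w}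
      (path_words (a + 1) \<times> path_words (b + 1))" (is "bij_betw ?f ?A _")
  proof (rule bij_betwI')
    fix x y assume "x \<in> ?A" "y \<in> ?A"
    then show "(?f x = ?f y) = (x = y)"
      by (auto simp: twin_words_def path_words_append_inject)
  next
    fix x assume "x \<in> ?A"
    with assms show "?f x \<in> path_words (a + 1) \<times> path_words (b + 1)"
      by (auto simp: twin_words_def path_words_Suc_iff path_words_Suc_snoc_iff)
  next
    fix y assume "y \<in> path_words (a + 1) \<times> path_words (b + 1)"
    then have "fst y \<in> path_words (a + Suc 0)" "snd y \<in> path_words (Suc b)" by auto
    then show "\<exists>x\<in>?A. y = ?f x"
      using assms
      by (elim path_words_split path_words_Suc_cases)
        (cases y, auto simp: twin_words_def path_words_0)
  qed
qed (auto simp: twin_monom_def add_ac)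

text \<open>The cut falls behind \<open>q\<close>, so both twins stay with \<open>u\<close>.\<close>

lemma path_sf_mult_eq_twin_sum_left:
  assumes "0 < a" "0 < b"
  shows "path_sf (a + 2) * path_sf b = twin_sum a b (\<lambda>(u, p, q, w). last u \<noteq> p \<and> p \<noteq> q)"
  unfolding path_sf_mult twin_sum_eq
proof (rule weighted_sum_reindex[symmetric])
  show "bij_betw (\<lambda>(u, p, q, w). (u @ [p, q], w))
      {x \<in> twin_words a b. case x of (u, p, q, w) \<Rightarrow> last u \<noteq> p \<and> p \<noteq> q}
      (path_words (a + 2) \<times> path_words b)" (is "bij_betw ?f ?A _")
  proof (rule bij_betwI')
    fix x y assume "x \<in> ?A" "y \<in> ?A"
    then show "(?f x = ?f y) = (x = y)"
      by (auto simp: twin_words_def path_words_append_inject)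
  next
    fix x assume "x \<in> ?A"
    with assms show "?f x \<in> path_words (a + 2) \<times> path_words b"
      using path_words_append_iff[of "fst x" a _ 2]
      by (auto simp: twin_words_def path_words_Suc_iff path_words_length numeral_2_eq_2)
  next
    fix y assume "y \<in> path_words (a + 2) \<times> path_words b"
    then have "fst y \<in> path_words (a + Suc (Suc 0))" "snd y \<in> path_words b" by auto
    then show "\<exists>x\<in>?A. y = ?f x"
      using assms
      by (elim path_words_split path_words_Suc_cases)
        (cases y, auto simp: twin_words_def path_words_0)
  qed
qed (auto simp: twin_monom_def add_ac)

text \<open>The cut falls before \<open>p\<close>, so both twins stay with \<open>w\<close>.\<close>

lemma path_sf_mult_eq_twin_sum_right:
  assumes "0 < a" "0 < b"
  shows "path_sf a * path_sf (b + 2) = twin_sum a b (\<lambda>(u, p, q, w). p \<noteq> q \<and> q \<noteq> hd w)"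
  unfolding path_sf_mult twin_sum_eq
proof (rule weighted_sum_reindex[symmetric])
  show "bij_betw (\<lambda>(u, p, q, w). (u, p # q # w))
      {x \<in> twin_words a b. case x of (u, p, q, w) \<Rightarrow> p \<noteq> q \<and> q \<noteq> hd w}
      (path_words a \<times> path_words (b + 2))" (is "bij_betw ?f ?A _")
  proof (rule bij_betwI')
    fix x y assume "x \<in> ?A" "y \<in> ?A"
    then show "(?f x = ?f y) = (x = y)"
      by (auto simp: twin_words_def)
  next
    fix x assume "x \<in> ?A"
    with assms show "?f x \<in> path_words a \<times> path_words (b + 2)"
      by (auto simp: twin_words_def path_words_Suc_iff)
  next
    fix y assume "y \<in> path_words a \<times> path_words (b + 2)"
    then have "fst y \<in> path_words a" "snd y \<in> path_words (Suc (Suc b))" by auto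
    then show "\<exists>x\<in>?A. y = ?f x"
      using assms
      by (elim path_words_Suc_cases) (cases y, auto simp: twin_words_def)
  qed
qed (auto simp: twin_monom_def add_ac)

text \<open>Only the edge between the twins remains, a component of its own with two
  vertices.\<close>

lemma path_sf_2_mult_eq_twin_sum:
  "path_sf a * (path_sf 2 * path_sf b) = twin_sum a b (\<lambda>(u, p, q, w). p \<noteq> q)"
proof -
  have "path_sf a * (path_sf 2 * path_sf b) =
      weighted_sum (path_words a \<times> path_words 2 \<times> path_words b)
        (\<lambda>(u, v, w). list_monom u + (list_monom v + list_monom w)) (\<lambda>_. 1)"
    unfolding path_sf_mult unfolding path_sf_def
    by (subst weighted_sum_mult)
      (simp_all add: finite_fibres_path_words finite_fibres_Times case_prod_unfold
        finite_fibres_Times[OF finite_fibres_path_words finite_fibres_path_words, unfolded case_prod_unfold])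
  also have "\<dots> = twin_sum a b (\<lambda>(u, p, q, w). p \<noteq> q)"
    unfolding twin_sum_eq
  proof (rule weighted_sum_reindex[symmetric])
    show "bij_betw (\<lambda>(u, p, q, w). (u, [p, q], w))
        {x \<in> twin_words a b. case x of (u, p, q, w) \<Rightarrow> p \<noteq> q}
        (path_words a \<times> path_words 2 \<times> path_words b)" (is "bij_betw ?f ?A _")
    proof (rule bij_betwI')
      fix x y assume "x \<in> ?A" "y \<in> ?A"
      then show "(?f x = ?f y) = (x = y)"
        by (auto simp: twin_words_def)
    next
      fix x assume "x \<in> ?A"
      then show "?f x \<in> path_words a \<times> path_words 2 \<times> path_words b"
        by (auto simp: twin_words_def path_words_Suc_iff numeral_2_eq_2)
    next
      fix y assume y: "y \<in> path_words a \<times> path_words 2 \<times> path_words b"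
      then have "fst (snd y) \<in> path_words (Suc (Suc 0))" by (auto simp: numeral_2_eq_2)
      with y show "\<exists>x\<in>?A. y = ?f x"
        by (elim path_words_Suc_cases) (cases y, auto simp: twin_words_def path_words_0)
    qed
  qed (auto simp: twin_monom_def add_ac)
  finally show ?thesis .
qed

section \<open>Colorings of the twin path\<close>

lemma map_upt_split:
  assumes "1 \<le> l" "l \<le> n"
  shows "map \<kappa> [1..<n + 1] = map \<kappa> [1..<l] @ \<kappa> l # map \<kappa> [l + 1..<n + 1]"
proof -
  have "[1..<n + 1] = [1..<l] @ [l..<n + 1]"
    using assms upt_add_eq_append[of 1 l "n + 1 - l"] by simp
  then show ?thesis
    using assms by (simp add: upt_conv_Cons del: upt_Suc)
qed

lemma twin_proper_iff:
  assumes "2 \<le> l" "l < n"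
  shows "(\<forall>x y. {x, y} \<in> snd (twin_path l n) \<longrightarrow> \<kappa> x \<noteq> \<kappa> y) \<longleftrightarrow>
    distinct_adj (map \<kappa> [1..<l] @ \<kappa> l # map \<kappa> [l + 1..<n + 1]) \<and>
    \<kappa> (l - 1) \<noteq> \<kappa> 0 \<and> \<kappa> 0 \<noteq> \<kappa> l \<and> \<kappa> 0 \<noteq> \<kappa> (l + 1)" (is "?L \<longleftrightarrow> ?R")
proof -
  have "?L \<longleftrightarrow> (\<forall>i. 1 \<le> i \<and> i < n \<longrightarrow> \<kappa> i \<noteq> \<kappa> (i + 1)) \<and>
      \<kappa> (l - 1) \<noteq> \<kappa> 0 \<and> \<kappa> 0 \<noteq> \<kappa> l \<and> \<kappa> 0 \<noteq> \<kappa> (l + 1)" (is "_ \<longleftrightarrow> ?M \<and> _")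
  proof (intro iffI conjI allI impI; (elim conjE)?)
    assume L: ?L
    then show "\<kappa> i \<noteq> \<kappa> (i + 1)" if "1 \<le> i" "i < n" for i
      using that by (auto simp: twin_path_def path_graph_def)
    from L show "\<kappa> (l - 1) \<noteq> \<kappa> 0" "\<kappa> 0 \<noteq> \<kappa> l" "\<kappa> 0 \<noteq> \<kappa> (l + 1)"
      by (simp_all add: twin_path_def insert_commute)
  next
    fix x y assume M: ?M and R: "\<kappa> (l - 1) \<noteq> \<kappa> 0" "\<kappa> 0 \<noteq> \<kappa> l" "\<kappa> 0 \<noteq> \<kappa> (l + 1)"
      and "{x, y} \<in> snd (twin_path l n)"
    then consider i where "1 \<le> i" "i < n" "{x, y} = {i, i + 1}"
      | "{x, y} = {0, l - 1}" | "{x, y} = {0, l}" | "{x, y} = {0, l + 1}"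
      by (auto simp: twin_path_def path_graph_def)
    then show "\<kappa> x \<noteq> \<kappa> y"
    proof cases
      case 1
      with M have "\<kappa> i \<noteq> \<kappa> (i + 1)" by blast
      with 1(3) show ?thesis by (auto simp: doubleton_eq_iff)
    qed (use R in \<open>auto simp: doubleton_eq_iff\<close>)
  qed
  also have "?M \<longleftrightarrow> distinct_adj (map \<kappa> [1..<n + 1])"
  proof
    assume ?M
    then show "distinct_adj (map \<kappa> [1..<n + 1])"
      by (auto simp: distinct_adj_conv_nth simp del: upt_Suc)
  next
    assume d: "distinct_adj (map \<kappa> [1..<n + 1])"
    show ?M
    proof (intro allI impI)
      fix i assume "1 \<le> i \<and> i < n"
      then show "\<kappa> i \<noteq> \<kappa> (i + 1)"
        using d[unfolded distinct_adj_conv_nth, rule_format, of "i - 1"] by (auto simp del: upt_Suc)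
    qed
  qed
  finally show ?thesis using assms map_upt_split[of l n \<kappa>] by simp
qed

lemma chromatic_twin_path_eq_twin_sum:
  assumes "2 \<le> l" "l < n"
  shows "chromatic_sf (twin_path l n) = twin_sum (l - 1) (n - l)
    (\<lambda>(u, p, q, w). p \<noteq> q \<and> last u \<noteq> p \<and> last u \<noteq> q \<and> p \<noteq> hd w \<and> q \<noteq> hd w)"
  unfolding chromatic_sf_def monom_sum_eq_weighted_sum twin_sum_eq
proof (rule weighted_sum_reindex)
  let ?f = "\<lambda>\<kappa>. (map \<kappa> [1..<l], \<kappa> 0, \<kappa> l, map \<kappa> [l + 1..<n + 1])"
  \<comment> \<open>In \<open>p # u @ q # w\<close> the color of vertex \<open>i\<close> stands at
    index \<open>i\<close>, as the new vertex is 0; the restriction restores the default value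
    outside the vertex set.\<close>
  let ?g = "\<lambda>(u, p, q, w). restrict (\<lambda>i. (p # u @ q # w) ! i) {0..n}"
  let ?A = "{x \<in> twin_words (l - 1) (n - l). case x of (u, p, q, w) \<Rightarrow>
    p \<noteq> q \<and> last u \<noteq> p \<and> last u \<noteq> q \<and> p \<noteq> hd w \<and> q \<noteq> hd w}"
  have V: "fst (twin_path l n) = {0..n}"
    by (auto simp: twin_path_def path_graph_def)
  have ends: "last (map \<kappa> [1..<l]) = \<kappa> (l - 1)" "hd (map \<kappa> [l + 1..<n + 1]) = \<kappa> (l + 1)"
 for \<kappa> :: "nat \<Rightarrow> nat"
    using assms by (auto simp: last_map hd_map last_upt hd_upt simp del: upt_Suc)
  \<comment> \<open>Stated for every \<open>\<kappa>\<close>, so that it serves both directions of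
    the bijection.\<close>
  have in_A: "?f \<kappa> \<in> ?A \<longleftrightarrow> (\<forall>i\<in>{0..n}. 1 \<le> \<kappa> i) \<and>
      (\<forall>x y. {x, y} \<in> snd (twin_path l n) \<longrightarrow> \<kappa> x \<noteq> \<kappa> y)" for \<kappa>
  proof -
    have "{0..n} = {0} \<union> {1..<l} \<union> {l} \<union> {l + 1..<n + 1}" using assms by auto
    then have pos: "(\<forall>i\<in>{0..n}. 1 \<le> \<kappa> i) \<longleftrightarrow> 1 \<le> \<kappa> 0 \<and> (\<forall>i\<in>{1..<l}. 1 \<le> \<kappa> i) \<and> 1 \<le> \<kappa> l \<and>
        (\<forall>i\<in>{l + 1..<n + 1}. 1 \<le> \<kappa> i)" by auto
    have adj: "distinct_adj (map \<kappa> [1..<l] @ \<kappa> l # map \<kappa> [l + 1..<n + 1]) \<longleftrightarrow>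
        distinct_adj (map \<kappa> [1..<l]) \<and> \<kappa> (l - 1) \<noteq> \<kappa> l \<and>
        distinct_adj (map \<kappa> [l + 1..<n + 1]) \<and> \<kappa> l \<noteq> \<kappa> (l + 1)"
      using assms by (simp add: distinct_adj_append_iff distinct_adj_Cons ends del: upt_Suc One_nat_def) blast
    have left: "map \<kappa> [1..<l] \<in> path_words (l - 1) \<longleftrightarrow>
        (\<forall>i\<in>{1..<l}. 1 \<le> \<kappa> i) \<and> distinct_adj (map \<kappa> [1..<l])"
      by (simp add: path_words_def words_def image_subset_iff del: upt_Suc)
    have right: "map \<kappa> [l + 1..<n + 1] \<in> path_words (n - l) \<longleftrightarrow>
        (\<forall>i\<in>{l + 1..<n + 1}. 1 \<le> \<kappa> i) \<and> distinct_adj (map \<kappa> [l + 1..<n + 1])"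
      by (simp add: path_words_def words_def image_subset_iff del: upt_Suc)
    show ?thesis
      unfolding twin_proper_iff[OF assms] pos adj twin_words_def mem_Collect_eq prod.case mem_Times_iff
        fst_conv snd_conv left right ends atLeast_iff
      by metis
  qed
  show "bij_betw ?f (proper_colorings (twin_path l n)) ?A"
  proof (rule bij_betw_byWitness[where f' = ?g])
    show "\<forall>\<kappa>\<in>proper_colorings (twin_path l n). ?g (?f \<kappa>) = \<kappa>"
    proof
      fix \<kappa> assume "\<kappa> \<in> proper_colorings (twin_path l n)"
      then have ext: "\<kappa> \<in> extensional {0..n}"
        by (auto simp: proper_colorings_def V PiE_def)
      have eq: "\<kappa> 0 # map \<kappa> [1..<l] @ \<kappa> l # map \<kappa> [l + 1..<n + 1] = map \<kappa> [0..<n + 1]"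
        using assms map_upt_split[of l n \<kappa>] by (simp add: upt_conv_Cons del: upt_Suc)
      show "?g (?f \<kappa>) = \<kappa>"
        using ext
        by (intro extensionalityI[OF _ ext])
          (simp_all only: prod.case eq, auto simp: extensional_def less_Suc_eq_le simp del: upt_Suc)
    qed
    show fg: "\<forall>x\<in>?A. ?f (?g x) = x"
    proof
      fix x assume "x \<in> ?A"
      then obtain u p q w where x: "x = (u, p, q, w)" and len: "length u = l - 1" "length w = n - l"
        by (auto simp: twin_words_def path_words_length)
      have "map (?g x) [1..<l] = u"
        using assms len by (intro nth_equalityI) (auto simp: x nth_append)
      moreover have "map (?g x) [l + 1..<n + 1] = w"
        using assms len by (intro nth_equalityI) (auto simp: x nth_append nth_Cons' simp del: upt_Suc)
      moreover have "?g x 0 = p" "?g x l = q"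
        using assms len by (auto simp: x nth_append nth_Cons')
      ultimately show "?f (?g x) = x" by (simp add: x del: upt_Suc)
    qed
    show "?f ` proper_colorings (twin_path l n) \<subseteq> ?A"
    proof (rule image_subsetI)
      fix \<kappa> assume "\<kappa> \<in> proper_colorings (twin_path l n)"
      then show "?f \<kappa> \<in> ?A"
        unfolding in_A by (auto simp: proper_colorings_def V PiE_def Pi_def)
    qed
    show "?g ` ?A \<subseteq> proper_colorings (twin_path l n)"
    proof (rule image_subsetI)
      fix x assume x: "x \<in> ?A"
      \<comment> \<open>As \<open>?g x\<close> is mapped back to \<open>x\<close>, its properness
        follows from \<open>in_A\<close> instead of a second inspection of the edges.\<close>
      then have "?f (?g x) \<in> ?A" using fg by (metis (no_types, lifting))
      then show "?g x \<in> proper_colorings (twin_path l n)"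
        unfolding in_A by (auto simp: proper_colorings_def V PiE_def Pi_def case_prod_unfold)
    qed
  qed
  fix \<kappa>
  have "(\<Sum>v\<in>{0..n}. Poly_Mapping.single (\<kappa> v) (1 :: nat)) = list_monom (map \<kappa> [0..<n + 1])"
    by (simp add: list_monom_def interv_sum_list_conv_sum_set_nat atLeastLessThanSuc_atLeastAtMost o_def del: upt_Suc)
  also have "map \<kappa> [0..<n + 1] = \<kappa> 0 # map \<kappa> [1..<l] @ \<kappa> l # map \<kappa> [l + 1..<n + 1]"
    using assms map_upt_split[of l n \<kappa>] by (simp add: upt_conv_Cons del: upt_Suc)
  finally show "(\<Sum>v\<in>fst (twin_path l n). Poly_Mapping.single (\<kappa> v) 1) = twin_monom (?f \<kappa>)"
    by (simp add: V twin_monom_def add_ac del: upt_Suc)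
qed simp

text \<open>
  Triple deletion for the two triangles \<open>x p q\<close> and \<open>p q y\<close> sharing the edge \<open>p q\<close>. It leaves stars with
  centre \<open>p\<close> (or \<open>q\<close>), which are rewritten through paths: when \<open>p = q\<close>, the edge \<open>p y\<close> may be replaced by \<open>q y\<close>.
\<close>

lemma twin_indicator:
  fixes x y p q :: nat
  shows "(of_bool (p \<noteq> q \<and> x \<noteq> p \<and> x \<noteq> q \<and> p \<noteq> y \<and> q \<noteq> y) :: 'a :: comm_ring_1) =
    of_bool (x \<noteq> p \<and> p \<noteq> y) + of_bool (x \<noteq> q \<and> q \<noteq> y)
    - of_bool (x \<noteq> p \<and> q \<noteq> y) - of_bool (x \<noteq> q \<and> p \<noteq> y)
    + of_bool (x \<noteq> p \<and> p \<noteq> q \<and> q \<noteq> y) + of_bool (x \<noteq> q \<and> q \<noteq> p \<and> p \<noteq> y)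
    + of_bool (x \<noteq> p \<and> p \<noteq> q \<and> q \<noteq> y) + of_bool (x \<noteq> q \<and> q \<noteq> p \<and> p \<noteq> y)
    - of_bool (x \<noteq> p \<and> p \<noteq> q) - of_bool (x \<noteq> q \<and> q \<noteq> p)
    - of_bool (p \<noteq> q \<and> q \<noteq> y) - of_bool (q \<noteq> p \<and> p \<noteq> y) + of_bool (p \<noteq> q)"
proof (cases "p = q")
  case True
  then show ?thesis by simp
next
  case False
  then show ?thesis
    by (cases "x = p"; cases "x = q"; cases "p = y"; cases "q = y") simp_all
qed

lemma chromatic_twin_path_eq:
  assumes "2 \<le> l" "l < n"
  defines "a \<equiv> l - 1" and "b \<equiv> n - l"
  shows "chromatic_sf (twin_path l n) =
    4 * path_sf (n + 1) + 2 * (path_sf 1 * path_sf n) - 2 * (path_sf (a + 1) * path_sf (b + 1))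
    - 2 * (path_sf (a + 2) * path_sf b) - 2 * (path_sf a * path_sf (b + 2))
    + (path_sf a * (path_sf 2 * path_sf b) :: 'a :: comm_ring_1 mps)"
proof -
  define T where "T = (\<lambda>P. twin_sum a b (\<lambda>(u, p, q, w). P u p q w) :: 'a mps)"
  have ab: "0 < a" "0 < b" "n + 1 = a + b + 2" "n = a + b + 1" using assms by auto
  have swap: "T P = T (\<lambda>u p q w. P u q p w)" for P
    unfolding T_def by (rule twin_sum_swap)
  let ?f1 = "\<lambda>u p q w. last u \<noteq> p \<and> p \<noteq> q \<and> q \<noteq> hd w"
  let ?f2 = "\<lambda>u p q w. last u \<noteq> p \<and> p \<noteq> hd w"
  let ?f3 = "\<lambda>u p q w. last u \<noteq> p \<and> q \<noteq> hd w"
  let ?f4 = "\<lambda>u p q w. last u \<noteq> p \<and> p \<noteq> q"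
  let ?f5 = "\<lambda>u p q w. p \<noteq> q \<and> q \<noteq> hd w"
  let ?f6 = "\<lambda>u p q w. p \<noteq> q"
  have "chromatic_sf (twin_path l n) =
      T (\<lambda>u p q w. p \<noteq> q \<and> last u \<noteq> p \<and> last u \<noteq> q \<and> p \<noteq> hd w \<and> q \<noteq> hd w)"
    unfolding T_def a_def b_def by (rule chromatic_twin_path_eq_twin_sum[OF assms(1,2)])
  \<comment> \<open>The indicator identity with \<open>x = last u\<close> and
    \<open>y = hd w\<close>, applied termwise.\<close>
  also have "\<dots> = T ?f2 + T (\<lambda>u p q w. ?f2 u q p w) - T ?f3 - T (\<lambda>u p q w. ?f3 u q p w)
      + T ?f1 + T (\<lambda>u p q w. ?f1 u q p w) + T ?f1 + T (\<lambda>u p q w. ?f1 u q p w)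
      - T ?f4 - T (\<lambda>u p q w. ?f4 u q p w) - T ?f5 - T (\<lambda>u p q w. ?f5 u q p w) + T ?f6"
    unfolding T_def twin_sum_def weighted_sum_add[symmetric] weighted_sum_diff[symmetric]
    by (rule weighted_sum_cong) (simp only: case_prod_unfold twin_indicator)
  \<comment> \<open>Twelve of the thirteen terms pair up under the exchange of \<open>p\<close> and
    \<open>q\<close>, which produces the coefficients 4 and 2.\<close>
  also have "\<dots> = 4 * T ?f1 + 2 * T ?f2 - 2 * T ?f3 - 2 * T ?f4 - 2 * T ?f5 + T ?f6"
    unfolding swap[of ?f1, symmetric] swap[of ?f2, symmetric] swap[of ?f3, symmetric]
      swap[of ?f4, symmetric] swap[of ?f5, symmetric]
    by (simp add: algebra_simps)
  finally show ?thesis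
    using ab(1,2) unfolding ab(3) unfolding ab(4) unfolding T_def
    by (simp only: path_sf_eq_twin_sum path_sf_1_mult_eq_twin_sum path_sf_mult_eq_twin_sum_middle
      path_sf_mult_eq_twin_sum_left path_sf_mult_eq_twin_sum_right path_sf_2_mult_eq_twin_sum)
qed

section \<open>The expansion in the elementary basis\<close>

lemma mps_smult_mult: "mps_smult c (f * g) = mps_smult c f * g"
  by (rule mps_eqI) (simp add: mps_smult.rep_eq times_mps.rep_eq sum_distrib_left mult.assoc)

lemma mps_smult_of_nat: "mps_smult (of_nat k) f = of_nat k * f"
proof (induction k)
  case 0
  show ?case by (rule mps_eqI) (simp add: mps_smult.rep_eq zero_mps.rep_eq)
next
  case (Suc k)
  have "mps_smult (of_nat (Suc k)) f = f + mps_smult (of_nat k) f"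
    by (rule mps_eqI) (simp add: mps_smult.rep_eq plus_mps.rep_eq algebra_simps)
  with Suc show ?case by (simp add: algebra_simps)
qed

lemma mps_smult_half_double: "mps_smult (1 / 2) (2 * f) = (f :: rat mps)"
proof (rule mps_eqI)
  fix m
  have "mps_coeff (2 * f) m = 2 * mps_coeff f m"
    by (simp only: mult_2 plus_mps.rep_eq)
  then show "mps_coeff (mps_smult (1 / 2) (2 * f)) m = mps_coeff f m"
    by (simp add: mps_smult.rep_eq)
qed

section \<open>Weights that vanish on parts below 2\<close>

definition e_first_ge2 :: "nat \<Rightarrow> 'a :: comm_ring_1 mps" where
  "e_first_ge2 k = (if 2 \<le> k then of_nat k * esym k else 0)"

text \<open>This weight absorbs the fractions of the theorem: \<open>(1 - 2 / i) * i = i - 2\<close>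
  for a first part, and \<open>(1 - 1 / (k - 1)) * (k - 1) = k - 2\<close> for a later part with
  \<open>k > 1\<close>.\<close>

definition e_minus2 :: "nat \<Rightarrow> 'a :: comm_ring_1 mps" where
  "e_minus2 k = of_nat (k - 2) * esym k"

lemma e_terms_eq_0: "k < 2 \<Longrightarrow> e_later k = 0" "k < 2 \<Longrightarrow> e_minus2 k = 0" "k < 2 \<Longrightarrow> e_first_ge2 k = 0"
  by (simp_all add: e_later_def e_minus2_def e_first_ge2_def)

lemma prod_list_e_later:
  "prod_list (map e_later I) = of_nat (\<Prod>i\<leftarrow>I. i - 1) * (esym_comp I :: 'a :: comm_ring_1 mps)"
  by (induction I) (simp_all add: e_later_def esym_comp_def mult_ac)

lemma comp_prod_e_first:
  "I \<noteq> [] \<Longrightarrow> comp_prod e_first e_later I = of_nat (comp_weight I) * (esym_comp I :: 'a :: comm_ring_1 mps)"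
  by (cases I) (simp_all add: comp_weight_def prod_list_e_later e_first_def esym_comp_def mult_ac)

lemma comp_prod_cong_hd: "\<phi> (hd I) = \<phi>' (hd I) \<Longrightarrow> comp_prod \<phi> \<psi> I = comp_prod \<phi>' \<psi> I"
  by (cases I) simp_all

lemma comp_prod_eq_0:
  assumes "i \<in> set I" "i < 2" "\<And>k. k < 2 \<Longrightarrow> \<phi> k = 0" "\<And>k. k < 2 \<Longrightarrow> \<psi> k = 0"
  shows "comp_prod \<phi> \<psi> I = 0"
proof (cases I)
  case (Cons j J)
  show ?thesis
  proof (cases "i = j")
    case False
    with assms Cons have "\<psi> i = 0" "i \<in> set J" by auto
    then have "0 \<in> set (map \<psi> J)" by force
    then have "prod_list (map \<psi> J) = 0" by (induction J) auto
    then show ?thesis by (simp add: Cons)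
  qed (use assms Cons in simp)
qed (use assms in simp)

text \<open>Weights vanishing below 2 kill every composition with a part 1, so sums over parts at
  least 2 become sums over all compositions, where cutting is available.\<close>

lemma sum_compositions_ge2:
  assumes "\<And>I. I \<in> compositions_ge2 n \<Longrightarrow> Q I \<Longrightarrow> g I = comp_prod \<phi> \<psi> I"
    and "\<And>k. k < 2 \<Longrightarrow> \<phi> k = 0" "\<And>k. k < 2 \<Longrightarrow> \<psi> k = 0"
  shows "(\<Sum>I | I \<in> compositions_ge2 n \<and> Q I. g I) = (\<Sum>I | I \<in> compositions n \<and> Q I. comp_prod \<phi> \<psi> I)"
proof (rule sum.mono_neutral_cong_left)
  show "\<forall>I\<in>{I. I \<in> compositions n \<and> Q I} - {I. I \<in> compositions_ge2 n \<and> Q I}. comp_prod \<phi> \<psi> I = 0"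
  proof
    fix I assume "I \<in> {I. I \<in> compositions n \<and> Q I} - {I. I \<in> compositions_ge2 n \<and> Q I}"
    then obtain i where "i \<in> set I" "i < 2"
      by (auto simp: compositions_ge2_def not_le)
    then show "comp_prod \<phi> \<psi> I = 0"
      by (rule comp_prod_eq_0) (fact assms)+
  qed
qed (auto simp: finite_compositions assms compositions_ge2_def)

lemma comp_prod_e_first_ge2:
  assumes "I \<in> compositions_ge2 n" "0 < n"
  shows "comp_prod e_first_ge2 e_later I = of_nat (comp_weight I) * (esym_comp I :: 'a :: comm_ring_1 mps)"
proof -
  have "I \<noteq> []" using assms by (auto simp: compositions_ge2_def compositions_def)
  moreover from this assms have "2 \<le> hd I" by (auto simp: compositions_ge2_def)
  ultimately show ?thesis
    by (subst comp_prod_cong_hd[where \<phi>' = e_first]) (simp_all add: comp_prod_e_first e_first_def e_first_ge2_def)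
qed

text \<open>The first part is either at least 2 or equal to 1; after a first part 1 only later
  weights remain.\<close>

lemma comp_sum_e_first:
  assumes "0 < n"
  shows "comp_sum e_first e_later n =
    comp_sum e_first_ge2 e_later n + esym 1 * (comp_sum e_later e_later (n - 1) :: 'a :: comm_ring_1 mps)"
proof -
  have "(e_first :: nat \<Rightarrow> 'a mps) = (\<lambda>k. e_first_ge2 k + (if k = 1 then esym 1 else 0))"
    by (rule ext) (auto simp: e_first_def e_first_ge2_def not_le less_Suc_eq numeral_2_eq_2)
  then show ?thesis
    using comp_sum_add[OF assms, of e_first_ge2 "\<lambda>k. if k = 1 then esym 1 else 0 :: 'a mps" e_later]
    by (simp only: comp_sum_first_one[OF assms])
qed

text \<open>For \<open>k \<ge> 2\<close> this is \<open>(k - 2) + k = 2 * (k - 1)\<close>. At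
  \<open>k = 1\<close> truncated subtraction leaves the defect \<open>e_1\<close>, which accounts
  for the last term.\<close>

lemma comp_sum_e_minus2:
  assumes "0 < n"
  shows "comp_sum e_minus2 e_later n + comp_sum e_first e_later n =
    2 * comp_sum e_later e_later n + esym 1 * (comp_sum e_later e_later (n - 1) :: 'a :: comm_ring_1 mps)"
proof -
  have "e_minus2 k + e_first k = 2 * e_later k + (if k = 1 then esym 1 else 0 :: 'a mps)" for k
  proof (cases "2 \<le> k")
    case True
    then obtain j where "k = j + 2" using le_Suc_ex by (metis add.commute)
    then show ?thesis by (simp add: e_minus2_def e_first_def e_later_def algebra_simps)
  qed (auto simp: e_minus2_def e_first_def e_later_def not_le less_Suc_eq numeral_2_eq_2)
  then show ?thesis
    unfolding comp_sum_add[OF assms, symmetric] comp_sum_cmult[OF assms, symmetric]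
      comp_sum_first_one[OF assms, symmetric] by (simp only:)
qed

text \<open>The inner \<open>comp_theta\<close> looks one unit beyond the cut, hence into the first
  part \<open>k\<close> after it, where it equals \<open>k - 1\<close>. Its factor turns the weight
  \<open>k - 1\<close> of that part into \<open>k - 2\<close>, so the product splits at the
  cut.\<close>

lemma sum_theta_next_part:
  fixes g :: "nat list \<Rightarrow> rat mps"
  assumes "0 < c" "c + 2 < n"
  defines "g \<equiv> \<lambda>K. mps_smult ((1 - 1 / of_nat (comp_theta K (c + 1 + comp_theta K c)))
    * of_nat (comp_weight K)) (esym_comp K)"
  shows "(\<Sum>K | K \<in> compositions_ge2 n \<and> comp_theta K c \<le> 2. g K) =
    (\<Sum>t\<in>{0,1,2}. tail_sum e_first_ge2 e_later c t * comp_sum e_minus2 e_later (n - (c + t)))"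
proof -
  \<comment> \<open>Extension by 0 to all compositions, so that the sum can be cut.\<close>
  define h where "h = (\<lambda>K. if K \<in> compositions_ge2 n then g K else 0)"
  have h: "h (J @ K) = comp_prod e_first_ge2 e_later J * comp_prod e_minus2 e_later K"
    if J: "J \<in> compositions (c + t)" "t < last J" and K: "K \<in> compositions (n - (c + t))" and t: "t \<le> 2"
    for J K t
  proof (cases "J @ K \<in> compositions_ge2 n")
    case True
    \<comment> \<open>Because \<open>c + 2 < n\<close>, something remains after the cut.\<close>
    from K t assms have "K \<noteq> []" by (auto simp: compositions_def)
    then obtain k K' where K': "K = k # K'" by (cases K) auto
    have k: "2 \<le> k" and J2: "J \<in> compositions_ge2 (c + t)"
      using True J by (auto simp: K' compositions_ge2_def)
    have ne: "J \<noteq> []" and sum_J: "sum_list J = c + t" using J assms by (auto simp: compositions_def)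
    have "comp_theta (J @ K) c = t"
      using ne sum_J J by (subst comp_theta_append) auto
    moreover have "comp_theta ((J @ [k]) @ K') (c + 1 + t) = k - 1"
      using k sum_J by (subst comp_theta_append) auto
    ultimately have theta: "comp_theta (J @ K) (c + 1 + comp_theta (J @ K) c) = k - 1"
      by (simp add: K')
    have weight: "comp_weight (J @ K) = comp_weight J * (k - 1) * (\<Prod>i\<leftarrow>K'. i - 1)"
      using ne by (cases J) (simp_all add: comp_weight_def K')
    \<comment> \<open>Here \<open>k \<ge> 2\<close> keeps the denominator nonzero; the coefficient
      becomes a natural number and \<open>mps_smult\<close> a ring multiplication.\<close>
    have "(1 - 1 / of_nat (k - 1)) * of_nat (comp_weight (J @ K)) =
        (of_nat (comp_weight J * (k - 2) * (\<Prod>i\<leftarrow>K'. i - 1)) :: rat)"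
      using k by (simp add: weight of_nat_diff field_simps)
    then have "g (J @ K) = of_nat (comp_weight J * (k - 2) * (\<Prod>i\<leftarrow>K'. i - 1)) * esym_comp (J @ K)"
      unfolding g_def theta by (simp only: mps_smult_of_nat)
    also have "\<dots> = comp_prod e_first_ge2 e_later J * comp_prod e_minus2 e_later K"
      using J2 assms(1)
      by (simp add: comp_prod_e_first_ge2 K' prod_list_e_later e_minus2_def esym_comp_def mult_ac)
    finally show ?thesis
      using True by (simp add: h_def)
  next
    case False
    with J K t assms obtain i where i: "i \<in> set J \<or> i \<in> set K" "i < 2"
      by (auto simp: compositions_ge2_def compositions_def not_le)
    then have "comp_prod e_first_ge2 e_later J = (0 :: rat mps) \<or> comp_prod e_minus2 e_later K = (0 :: rat mps)"
      using comp_prod_eq_0[OF _ i(2), where ?'a = "rat mps"] e_terms_eq_0 by metis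
    with False show ?thesis by (auto simp: h_def)
  qed
  have "(\<Sum>K | K \<in> compositions_ge2 n \<and> comp_theta K c \<le> 2. g K) =
      (\<Sum>K | K \<in> compositions n \<and> comp_theta K c \<le> 2. h K)"
    by (rule sum.mono_neutral_cong_left) (auto simp: h_def compositions_ge2_def finite_compositions)
  also have "\<dots> = (\<Sum>t\<in>{0,1,2}. \<Sum>K | K \<in> compositions n \<and> comp_theta K c = t. h K)"
    by (rule sum_theta_le_2)
  also have "\<dots> = (\<Sum>t\<in>{0,1,2}. tail_sum e_first_ge2 e_later c t * comp_sum e_minus2 e_later (n - (c + t)))"
  proof (rule sum.cong[OF refl])
    fix t :: nat assume "t \<in> {0,1,2}"
    then have t: "t \<le> 2" "c + t \<le> n" using assms by auto
    show "(\<Sum>K | K \<in> compositions n \<and> comp_theta K c = t. h K) =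
        tail_sum e_first_ge2 e_later c t * comp_sum e_minus2 e_later (n - (c + t))"
      unfolding sum_comp_theta_eq[OF assms(1) t(2)] tail_sum_def comp_sum_def sum_product
      by (intro sum.cong refl) (auto intro: h t)
  qed
  finally show ?thesis .
qed

theorem theorem4p1:
  fixes n l :: nat
  assumes "3 \<le> n" and "2 \<le> l" and "l \<le> n - 1"
  shows "mps_smult (1 / 2) (chromatic_sf (twin_path l n) :: rat mps) =
      (\<Sum>I | I \<in> compositions n \<and> comp_theta I (l - 1) \<ge> 3.
         mps_smult (of_nat (comp_weight I)) (esym_comp (I @ [1])))
    + (\<Sum>I | I \<in> compositions_ge2 n \<and> comp_theta I (n - l) \<ge> 3.
         mps_smult (of_nat (comp_weight I)) (esym_comp (I @ [1])))
    + (\<Sum>I\<in>compositions_ge2 n.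
         mps_smult ((1 - 2 / of_nat (hd I)) * of_nat (comp_weight I)) (esym_comp (I @ [1])))
    + (\<Sum>K | K \<in> compositions_ge2 (n + 1) \<and> comp_theta K (l - 1) \<le> 2.
         mps_smult ((1 - 1 / of_nat (comp_theta K (l + comp_theta K (l - 1))))
           * of_nat (comp_weight K)) (esym_comp K))
    + (\<Sum>K | K \<in> compositions_ge2 (n + 1) \<and> comp_theta K (l - 1) \<ge> 3.
         mps_smult (2 * of_nat (comp_weight K)) (esym_comp K))"
proof -
  define a where "a = l - 1"
  define b where "b = n - l"
  have ab: "0 < a" "0 < b" "n = a + b + 1" "l = a + 1" "l - 1 = a" "n - l = b" "0 < n"
    using assms by (auto simp: a_def b_def)
  define P P' A :: "nat \<Rightarrow> rat mps" where "P = comp_sum e_first e_later"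
    and "P' = comp_sum e_first_ge2 e_later" and "A = comp_sum e_later e_later"
  define e1 e2 :: "rat mps" where "e1 = esym 1" and "e2 = esym 2"
  have P: "P m = P' m + e1 * A (m - 1)" if "0 < m" for m
    unfolding P_def P'_def A_def e1_def by (rule comp_sum_e_first[OF that])
  \<comment> \<open>Eliminates the weight \<open>e_minus2\<close> from the third and fourth
    sums.\<close>
  have B: "comp_sum e_minus2 e_later m = 2 * A m + e1 * A (m - 1) - P m" if "0 < m" for m
    using comp_sum_e_minus2[OF that, where ?'a = rat]
    unfolding P_def A_def e1_def by (simp add: algebra_simps)
  have snoc: "esym_comp (I @ [1]) = esym_comp I * e1" for I
    by (simp add: esym_comp_def e1_def)
  have later: "e_later 1 = (0 :: rat mps)" "e_later 2 = e2"
    by (simp_all add: e2_def e_later_def)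

  \<comment> \<open>A first part 1 is allowed here, so prefixes up to the cut give \<open>P\<close>;
    behind the cut all parts are later ones, which gives \<open>A\<close>.\<close>
  have S1: "(\<Sum>I | I \<in> compositions n \<and> comp_theta I (l - 1) \<ge> 3.
      mps_smult (of_nat (comp_weight I)) (esym_comp (I @ [1]))) =
    (P n - P a * A (n - a) - P (a + 1) * A (n - (a + 1)) - (P (a + 2) - e2 * P a) * A (n - (a + 2))) * e1"
  proof -
    have "mps_smult (of_nat (comp_weight I)) (esym_comp (I @ [1])) = comp_prod e_first e_later I * e1"
      if "I \<in> compositions n" for I
      by (simp only: snoc mps_smult_mult mps_smult_of_nat
          comp_prod_e_first[OF compositions_nonempty[OF ab(7) that]])
    then show ?thesis
      using comp_sum_theta_ge_3[of a n e_later e_first, OF ab(1) _ later(1)] ab later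
      by (simp add: P_def A_def flip: sum_distrib_right)
  qed
  \<comment> \<open>All parts are at least 2 and the cut is made at \<open>b\<close>, so
    \<open>P'\<close> takes the place of \<open>P\<close>.\<close>
  have S2: "(\<Sum>I | I \<in> compositions_ge2 n \<and> comp_theta I (n - l) \<ge> 3.
      mps_smult (of_nat (comp_weight I)) (esym_comp (I @ [1]))) =
    (P' n - P' b * A (n - b) - P' (b + 1) * A (n - (b + 1)) - (P' (b + 2) - e2 * P' b) * A (n - (b + 2))) * e1"
  proof -
    have "(\<Sum>I | I \<in> compositions_ge2 n \<and> comp_theta I (n - l) \<ge> 3.
        mps_smult (of_nat (comp_weight I)) (esym_comp (I @ [1]))) =
      (\<Sum>I | I \<in> compositions_ge2 n \<and> comp_theta I b \<ge> 3. of_nat (comp_weight I) * esym_comp I) * e1"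
      by (simp only: snoc mps_smult_mult mps_smult_of_nat sum_distrib_right ab(6))
    also have "(\<Sum>I | I \<in> compositions_ge2 n \<and> comp_theta I b \<ge> 3. of_nat (comp_weight I) * esym_comp I) =
        (\<Sum>I | I \<in> compositions n \<and> comp_theta I b \<ge> 3. comp_prod e_first_ge2 e_later I :: rat mps)"
      by (rule sum_compositions_ge2)
        (use assms in \<open>auto intro: comp_prod_e_first_ge2[symmetric] simp: e_terms_eq_0\<close>)
    finally show ?thesis
      using comp_sum_theta_ge_3[of b n e_later e_first_ge2, OF ab(2) _ later(1)] ab later
      by (simp add: P'_def A_def)
  qed
  have S3: "(\<Sum>I\<in>compositions_ge2 n.
      mps_smult ((1 - 2 / of_nat (hd I)) * of_nat (comp_weight I)) (esym_comp (I @ [1]))) =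
    (2 * A n + e1 * A (n - 1) - P n) * e1"
  proof -
    have "mps_smult ((1 - 2 / of_nat (hd I)) * of_nat (comp_weight I)) (esym_comp (I @ [1])) =
        comp_prod e_minus2 e_later I * e1" if "I \<in> compositions_ge2 n" for I
    proof -
      from that assms obtain i J where I: "I = i # J" "2 \<le> i"
        by (cases I) (auto simp: compositions_ge2_def compositions_def)
      then have "(1 - 2 / of_nat (hd I)) * of_nat (comp_weight I) =
          (of_nat ((i - 2) * (\<Prod>j\<leftarrow>J. j - 1)) :: rat)"
        by (simp add: comp_weight_def of_nat_diff field_simps)
      then show ?thesis
        by (simp only: snoc mps_smult_mult mps_smult_of_nat)
          (simp add: I prod_list_e_later e_minus2_def esym_comp_def mult_ac)
    qed
    then have "(\<Sum>I\<in>compositions_ge2 n.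
        mps_smult ((1 - 2 / of_nat (hd I)) * of_nat (comp_weight I)) (esym_comp (I @ [1]))) =
      (\<Sum>I\<in>compositions_ge2 n. comp_prod e_minus2 e_later I) * e1"
      by (simp add: sum_distrib_right)
    \<comment> \<open>The trivial condition brings the sum into the form of
      \<open>sum_compositions_ge2\<close>.\<close>
    also have "(\<Sum>I\<in>compositions_ge2 n. comp_prod e_minus2 e_later I) =
        (\<Sum>I | I \<in> compositions_ge2 n \<and> True. comp_prod e_minus2 e_later I :: rat mps)"
      by simp
    also have "\<dots> = (\<Sum>I | I \<in> compositions n \<and> True. comp_prod e_minus2 e_later I)"
      by (rule sum_compositions_ge2) (auto simp: e_terms_eq_0)
    also have "\<dots> = comp_sum e_minus2 e_later n"
      by (simp add: comp_sum_def)
    finally show ?thesis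
      using assms by (simp add: B)
  qed
  have S4: "(\<Sum>K | K \<in> compositions_ge2 (n + 1) \<and> comp_theta K (l - 1) \<le> 2.
         mps_smult ((1 - 1 / of_nat (comp_theta K (l + comp_theta K (l - 1))))
           * of_nat (comp_weight K)) (esym_comp K)) =
    P' a * (2 * A (b + 2) + e1 * A (b + 1) - P (b + 2))
    + P' (a + 1) * (2 * A (b + 1) + e1 * A b - P (b + 1))
    + (P' (a + 2) - e2 * P' a) * (2 * A b + e1 * A (b - 1) - P b)"
  proof -
    have "tail_sum e_first_ge2 e_later a 0 = P' a" "tail_sum e_first_ge2 e_later a 1 = P' (a + 1)"
      "tail_sum e_first_ge2 e_later a 2 = P' (a + 2) - e2 * P' a"
      using tail_sum_0[OF ab(1), of e_first_ge2 e_later] tail_sum_1[of a e_later e_first_ge2, OF ab(1) later(1)]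
        tail_sum_2[of a e_later e_first_ge2, OF ab(1) later(1)] later
      by (simp_all add: P'_def)
    \<comment> \<open>All three remainders are positive, so \<open>B\<close> applies to
      each.\<close>
    moreover have "n + 1 - (a + 0) = b + 2" "n + 1 - (a + 1) = b + 1" "n + 1 - (a + 2) = b"
      using ab(3) by auto
    ultimately show ?thesis
      using sum_theta_next_part[of a "n + 1"] ab
      by (simp add: B)
  qed
  have S5: "(\<Sum>K | K \<in> compositions_ge2 (n + 1) \<and> comp_theta K (l - 1) \<ge> 3.
      mps_smult (2 * of_nat (comp_weight K)) (esym_comp K)) =
    2 * (P' (n + 1) - P' a * A (b + 2) - P' (a + 1) * A (b + 1) - (P' (a + 2) - e2 * P' a) * A b)"
  proof -
    have "mps_smult (2 * of_nat k) f = 2 * (of_nat k * f)" for k and f :: "rat mps"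
      using mps_smult_of_nat[of "2 * k" f] by (simp add: mult.assoc)
    then have "(\<Sum>K | K \<in> compositions_ge2 (n + 1) \<and> comp_theta K (l - 1) \<ge> 3.
        mps_smult (2 * of_nat (comp_weight K)) (esym_comp K)) =
      2 * (\<Sum>K | K \<in> compositions_ge2 (n + 1) \<and> comp_theta K a \<ge> 3. of_nat (comp_weight K) * esym_comp K :: rat mps)"
      by (simp only: sum_distrib_left ab(5))
    also have "(\<Sum>K | K \<in> compositions_ge2 (n + 1) \<and> comp_theta K a \<ge> 3. of_nat (comp_weight K) * esym_comp K) =
        (\<Sum>I | I \<in> compositions (n + 1) \<and> comp_theta I a \<ge> 3. comp_prod e_first_ge2 e_later I :: rat mps)"
      by (rule sum_compositions_ge2) (auto intro: comp_prod_e_first_ge2[symmetric] simp: e_terms_eq_0)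
    also have "\<dots> = P' (n + 1) - P' a * A (b + 2) - P' (a + 1) * A (b + 1) - (P' (a + 2) - e2 * P' a) * A b"
      using comp_sum_theta_ge_3[of a "n + 1" e_later e_first_ge2, OF ab(1) _ later(1)] ab(2,3) later
      by (simp add: P'_def A_def)
    finally show ?thesis .
  qed

  \<comment> \<open>\<open>P 2 = 2 * e2\<close> makes the last product in the chromatic formula
    even, so that 2 can be factored out.\<close>
  have P1: "P 1 = e1" and P2: "P 2 = 2 * e2"
    by (simp_all add: P_def comp_sum_rec e1_def e2_def e_first_def e_later_def numeral_2_eq_2)
  have "chromatic_sf (twin_path l n) = 2 * (2 * P (n + 1) + e1 * P n - P (a + 1) * P (b + 1)
      - P (a + 2) * P b - P a * P (b + 2) + e2 * P a * P b)"
    using chromatic_twin_path_eq[of l n, where ?'a = rat] assms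
    unfolding path_sf_eq_comp_sum P_def[symmetric] P1 P2 ab(5,6)
    by (simp add: algebra_simps)
  then have X: "mps_smult (1 / 2) (chromatic_sf (twin_path l n)) =
      2 * P (n + 1) + e1 * P n - P (a + 1) * P (b + 1)
      - P (a + 2) * P b - P a * P (b + 2) + e2 * P a * P b"
    by (simp only: mps_smult_half_double)
  have idx: "n - a = b + 1" "n - (a + 1) = b" "n - (a + 2) = b - 1"
    "n - b = a + 1" "n - (b + 1) = a" "n - (b + 2) = a - 1"
    using ab(3) by auto
  \<comment> \<open>Rewriting every \<open>P\<close> through \<open>P'\<close>, \<open>A\<close> and
    \<open>e1\<close> leaves an identity that holds in any commutative ring, with the remaining
    values as indeterminates.\<close>
  have expand: "P (n + 1) = P' (n + 1) + e1 * A n" "P n = P' n + e1 * A (n - 1)"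
    "P a = P' a + e1 * A (a - 1)" "P (a + 1) = P' (a + 1) + e1 * A a"
    "P (a + 2) = P' (a + 2) + e1 * A (a + 1)" "P b = P' b + e1 * A (b - 1)"
    "P (b + 1) = P' (b + 1) + e1 * A b" "P (b + 2) = P' (b + 2) + e1 * A (b + 1)"
    using ab(1,2) assms(1) by (simp_all add: P)
  show ?thesis
    unfolding S1 S2 S3 S4 S5 X idx unfolding expand
    by (simp only: algebra_simps)
qed

end
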